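(* Let $r=pq-p-q$ and let $G\subseteq\widetilde\Gamma$ be the subgroup generated by $\alpha^{r}$ and $\beta^{r}$. Define $$\Psi\colon \mathbb H^2\times\widetilde{\mathbb C^\times}\to\mathbb C^2,\qquad \Psi(z,w)=(\omega_b(z,w),\,\omega_a(z,w)).$$ Then $\Psi$ is constant on the orbits of $G$ (acting by $\gamma(z,w)=(\gamma(z),\gamma'(z)w)$), so it induces a map $\overline\Psi\colon M:=(\mathbb H^2\times\widetilde{\mathbb C^\times})/G\to\mathbb C^2$; the image of $\overline\Psi$ is contained in $\mathbb C^2\setminus V$, where $V=\{(z_1,z_2)\in\mathbb C^2: c_b z_1^q+c_a z_2^p=0\}$ and $c_a,c_b$ are the nonzero constants with $\omega_\infty=c_a\omega_a^p+c_b\omega_b^q$; and $\overline\Psi\colon M\to\mathbb C^2\setminus V$ is biholomorphic.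
   Context: Fix coprime integers $2\le p<q$. Let $\mathbb H^2=\{z\in\mathbb C:\operatorname{Im}z>0\}$, with $PSL_2(\mathbb R)$ acting by Möbius transformations. $\widetilde{SL_2}(\mathbb R)$ is the universal covering group of $PSL_2(\mathbb R)$ with covering homomorphism $\tilde P$; it acts on $\mathbb H^2$ through $\tilde P$. Let $\widetilde{\mathbb C^\times}$ be the universal cover of $\mathbb C^\times$, identified with $\mathbb C$ via $u\mapsto e^u$ (elements written $e^u$, $u\in\mathbb C$); for $k\in\mathbb Q$ put $(e^u)^k=e^{ku}$, and write $\bar w\in\mathbb C^\times$ for the image of $w$. Each $\gamma\in\widetilde{SL_2}(\mathbb R)$ has a derivative $\gamma'\colon\mathbb H^2\to\widetilde{\mathbb C^\times}$, the lift of $\frac{d}{dz}\tilde P(\gamma)(z)$ determined by continuity in $\gamma$ with $\mathrm{id}'=1$ (so the chain rule $(\gamma_2\gamma_1)'(z)=\gamma_2'(\gamma_1 z)\gamma_1'(z)$ holds); $\widetilde{SL_2}(\mathbb R)$ acts freely on $\mathbb H^2\times\widetilde{\mathbb C^\times}$ by $\gamma(z,w)=(\gamma(z),\gamma'(z)w)$. The center $C=\ker\tilde P\cong\mathbb Z$ is generated by $c$, which acts trivially on $\mathbb H^2$ with $c'(z)=e^{2\pi i}$. A form of degree $k\in\mathbb Q$ is a function $\omega(z,w)=f(z)\,\overline{w^k}$ on $\mathbb H^2\times\widetilde{\mathbb C^\times}$ with $f$ holomorphic on $\mathbb H^2$ (written $\omega=f\,dz^k$). Let $\alpha_0,\beta_0\in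 PSL_2(\mathbb R)$ be the classes of $A_0=\begin{pmatrix}2\cos(\pi/p)&1\\-1&0\end{pmatrix}$ and $B_0=\begin{pmatrix}0&1\\-1&2\cos(\pi/q)\end{pmatrix}$, and $\Gamma_{p,q}=\langle\alpha_0,\beta_0\rangle$ (the $(p,q,\infty)$-triangle group, $\cong\langle\alpha_0,\beta_0\mid\alpha_0^p=\beta_0^q=1\rangle$). Its elliptic fixed points are $a=-\cos(\pi/p)+i\sin(\pi/p)$ (for $\alpha_0$) and $b=\cos(\pi/q)+i\sin(\pi/q)$ (for $\beta_0$); it has one cusp class, that of $\infty$, stabilized by $\gamma_0=(\alpha_0\beta_0)^{-1}\colon z\mapsto z+\lambda$, $\lambda=2(\cos\frac\pi p+\cos\frac\pi q)$. Let $\widetilde\Gamma=\tilde P^{-1}(\Gamma_{p,q})$ and let $\alpha,\beta\in\widetilde\Gamma$ be the unique lifts of $\alpha_0,\beta_0$ with $\alpha^p=\beta^q=c$. Let $\theta\colon\mathbb H^2\to\mathbb C$ be a holomorphic $\Gamma_{p,q}$-invariant function inducing a bijection $\mathbb H^2/\Gamma_{p,q}\to\mathbb C$ with $\theta(a)=0$, $\theta(b)=1$ (it has a simple pole at the cusp $\infty$). Let $r=pq-p-q$ and let $f_a,f_b,f_\infty$ be holomorphic branches on $\mathbb H^2$ of $$\Big(\tfrac{(\theta')^q}{\theta(\theta-1)^{q-1}}\Big)^{1/r},\quad \Big(\tfrac{(\theta')^p}{\theta^{p-1}(\theta-1)}\Big)^{1/r},\quad \Big(\tfrac{(\theta')^{pq}}{\theta^{(p-1)q}(\theta-1)^{p(q-1)}}\Big)^{1/r}$$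 respectively, and set $\omega_a=f_a\,dz^{q/r}$, $\omega_b=f_b\,dz^{p/r}$, $\omega_\infty=f_\infty\,dz^{pq/r}$. (It is a result of the paper that $\omega_\infty=c_a\omega_a^p+c_b\omega_b^q$ for some nonzero constants $c_a,c_b$, and that $\omega_\infty$ vanishes nowhere on $\mathbb H^2\times\widetilde{\mathbb C^\times}$.) *)

theory Defs
  imports "HOL-Analysis.Analysis"
begin

definition UHP :: "complex set" where "UHP = {z. Im z > 0}"

text \<open>Real 2x2 matrices (a,b,c,d) = [[a,b],[c,d]].\<close>
type_synonym mat2 = "real \<times> real \<times> real \<times> real"

fun mmul :: "mat2 \<Rightarrow> mat2 \<Rightarrow> mat2" where
  "mmul (a,b,c,d) (e,f,g,h) = (a*e+b*g, a*f+b*h, c*e+d*g, c*f+d*h)"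

fun minv :: "mat2 \<Rightarrow> mat2" where
  "minv (a,b,c,d) = (d, -b, -c, a)"

fun mdet :: "mat2 \<Rightarrow> real" where
  "mdet (a,b,c,d) = a*d - b*c"

definition mat_id :: mat2 where "mat_id = (1,0,0,1)"

fun moeb :: "mat2 \<Rightarrow> complex \<Rightarrow> complex" where
  "moeb (a,b,c,d) z = (of_real a * z + of_real b) / (of_real c * z + of_real d)"

definition A0 :: "nat \<Rightarrow> mat2" where "A0 p = (2 * cos (pi / real p), 1, -1, 0)"
definition B0 :: "nat \<Rightarrow> mat2" where "B0 q = (0, 1, -1, 2 * cos (pi / real q))"

text \<open>Group of matrices generated by a set S (determinant-one generators).\<close>
inductive_set mgen :: "mat2 set \<Rightarrow> mat2 set" for S where
  mgen_id: "mat_id \<in> mgen S"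
| mgen_l: "s \<in> S \<Longrightarrow> g \<in> mgen S \<Longrightarrow> mmul s g \<in> mgen S"
| mgen_li: "s \<in> S \<Longrightarrow> g \<in> mgen S \<Longrightarrow> mmul (minv s) g \<in> mgen S"

definition Gamma_pq :: "nat \<Rightarrow> nat \<Rightarrow> mat2 set" where
  "Gamma_pq p q = mgen {A0 p, B0 q}"

text \<open>Model of the universal cover of PSL2(R): pairs (g, L) with L a continuous
  branch on the upper half plane of log of the derivative of z \<mapsto> moeb g z.
  The covering map forgets L; H2 x (universal cover of C^x) is modelled as
  UHP x C via u \<mapsto> e^u, so the action is (z,u) \<mapsto> (g z, u + L z).\<close>
type_synonym lift = "mat2 \<times> (complex \<Rightarrow> complex)"

definition is_lift :: "lift \<Rightarrow> bool" where
  "is_lift x \<longleftrightarrow> mdet (fst x) = 1 \<and> continuous_on UHP (snd x) \<and>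
     (\<forall>z\<in>UHP. exp (snd x z) = deriv (moeb (fst x)) z)"

fun lmul :: "lift \<Rightarrow> lift \<Rightarrow> lift" where
  "lmul (g2, L2) (g1, L1) = (mmul g2 g1, \<lambda>z. L2 (moeb g1 z) + L1 z)"

fun linv :: "lift \<Rightarrow> lift" where
  "linv (g, L) = (minv g, \<lambda>z. - L (moeb (minv g) z))"

definition lid :: lift where "lid = (mat_id, \<lambda>z. 0)"

fun lpow :: "lift \<Rightarrow> nat \<Rightarrow> lift" where
  "lpow x 0 = lid"
| "lpow x (Suc n) = lmul x (lpow x n)"

text \<open>x represents the central generator c (acts trivially, derivative e^{2 pi i}).\<close>
definition is_c :: "lift \<Rightarrow> bool" where
  "is_c x \<longleftrightarrow> (\<forall>z\<in>UHP. moeb (fst x) z = z \<and> snd x z = 2 * pi * \<i>)"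

fun lact :: "lift \<Rightarrow> complex \<times> complex \<Rightarrow> complex \<times> complex" where
  "lact (g, L) (z, u) = (moeb g z, u + L z)"

inductive_set lgen :: "lift set \<Rightarrow> lift set" for S where
  lgen_id: "lid \<in> lgen S"
| lgen_l: "s \<in> S \<Longrightarrow> g \<in> lgen S \<Longrightarrow> lmul s g \<in> lgen S"
| lgen_li: "s \<in> S \<Longrightarrow> g \<in> lgen S \<Longrightarrow> lmul (linv s) g \<in> lgen S"

definition clinear2 :: "(complex \<times> complex \<Rightarrow> complex \<times> complex) \<Rightarrow> bool" where
  "clinear2 D \<longleftrightarrow> linear D \<and> (\<forall>c v. D (c * fst v, c * snd v) = (c * fst (D v), c * snd (D v)))"

end

theory Submission
  imports Defs "HOL-Complex_Analysis.Complex_Analysis" "HOL-Number_Theory.Cong"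
begin

text \<open>
  The form \<open>fa\<^sup>p / finf\<close> is a constant multiple of \<open>\<theta>\<close>, so \<open>\<Psi>\<close> determines the
  \<open>\<Gamma>\<close>-orbit of \<open>z\<close>; what remains is bookkeeping with roots of unity in the fibre, and the
  Jacobian of \<open>\<Psi>\<close> is governed by \<open>deriv \<theta>\<close>. All of this rests on the
  ramification of \<open>\<theta>\<close>: order \<open>p\<close> over 0, \<open>q\<close> over 1, and 1 elsewhere. If \<open>\<theta>\<close> has order
  \<open>n\<close> at \<open>z0\<close>, then near \<open>z0\<close> there is a rotation of order \<open>n\<close> preserving \<open>\<theta>\<close>; since
  \<open>\<Gamma>\<close> is countable and transitive on the fibres, the identity theorem shows that this rotation is
  the action of an element of \<open>\<Gamma>\<close>, so no discreteness of \<open>\<Gamma>\<close> is needed. Finally, an element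
  of \<open>\<Gamma>\<close> with a fixed point is conjugate to a power of a generator, because every other cyclically
  reduced word in the generators has a sign pattern that forces its trace to have absolute value at least 2.
\<close>

section \<open>Moebius transformations\<close>

text \<open>The group \<open>G\<close> is dictated by two competing requirements. A lift of an
  element of \<open>\<Gamma>\<close> multiplies each of the forms by an r-th root of unity, so r-th
  powers of lifts leave \<open>\<Psi>\<close> unchanged; hence the generators
  \<open>lpow (A, La) r\<close> and \<open>lpow (B, Lb) r\<close>. On the other side
  \<open>G\<close> has to be large enough to make every fibre of \<open>\<Psi>\<close> a single
  orbit. Since r is coprime to p and q, \<open>G\<close> still maps onto the action of
  \<open>\<Gamma>\<close> on the half plane, and it contains the r-th power of the central element.
  In the variable u the components of \<open>\<Psi>\<close> have periods 2 pi i r / p and 2 pi i r /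
  q. As p and q are coprime, the common period is 2 pi i r, which is exactly that central
  translation. Over an elliptic point one component vanishes, so only one period survives; the
  larger ambiguity is matched by the larger stabilizer there, generated by a conjugate of an r-th
  power of a lift.\<close>

fun autf :: "mat2 \<Rightarrow> complex \<Rightarrow> complex" where
  "autf (a,b,c,d) z = of_real c * z + of_real d"

lemma UHP_iff [simp]: "z \<in> UHP \<longleftrightarrow> Im z > 0"
  by (simp add: UHP_def)

lemma open_UHP: "open UHP"
  unfolding UHP_def by (rule open_halfspace_Im_gt)

lemma connected_UHP: "connected UHP"
  unfolding UHP_def by (rule connected_halfspace_Im_gt)

lemma mmul_assoc: "mmul (mmul x y) z = mmul x (mmul y z)"
  by (cases x; cases y; cases z) (simp add: algebra_simps)

lemma mmul_id [simp]: "mmul mat_id x = x" "mmul x mat_id = x"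
  by (cases x; simp add: mat_id_def)+

lemma mdet_mmul: "mdet (mmul x y) = mdet x * mdet y"
  by (cases x; cases y) (simp add: algebra_simps)

lemma mdet_minv [simp]: "mdet (minv x) = mdet x"
  by (cases x) (simp add: algebra_simps)

lemma mdet_id [simp]: "mdet mat_id = 1"
  by (simp add: mat_id_def)

lemma mmul_minv: "mdet x = 1 \<Longrightarrow> mmul (minv x) x = mat_id"
  by (cases x) (auto simp: mat_id_def algebra_simps)

lemma autf_nonzero: "mdet g = 1 \<Longrightarrow> Im z > 0 \<Longrightarrow> autf g z \<noteq> 0"
  by (cases g) (auto simp: complex_eq_iff)

lemma moeb_id [simp]: "moeb mat_id z = z"
  by (simp add: mat_id_def)

lemma moeb_mmul:
  assumes "mdet h = 1" "Im z > 0"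
  shows "moeb (mmul g h) z = moeb g (moeb h z)"
proof -
  obtain a b c d where g: "g = (a,b,c,d)" by (cases g)
  obtain a' b' c' d' where h: "h = (a',b',c',d')" by (cases h)
  have nz: "of_real c' * z + of_real d' \<noteq> 0"
    using autf_nonzero[OF assms] by (simp add: h)
  define D where "D = of_real c' * z + of_real d'"
  define N where "N = of_real a' * z + of_real b'"
  have "moeb g (moeb h z) = (of_real a * (N / D) + of_real b) / (of_real c * (N / D) + of_real d)"
    by (simp add: g h N_def D_def)
  also have "\<dots> = ((of_real a * (N / D) + of_real b) * D) / ((of_real c * (N / D) + of_real d) * D)"
    using nz by (simp add: D_def)
  also have "\<dots> = (of_real a * N + of_real b * D) / (of_real c * N + of_real d * D)"
    using nz by (simp add: distrib_right flip: D_def)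
  also have "\<dots> = moeb (mmul g h) z"
    by (simp add: g h N_def D_def algebra_simps)
  finally show ?thesis by simp
qed

lemma autf_mmul:
  assumes "mdet h = 1" "Im z > 0"
  shows "autf (mmul g h) z = autf g (moeb h z) * autf h z"
proof -
  obtain a b c d where g: "g = (a,b,c,d)" by (cases g)
  obtain a' b' c' d' where h: "h = (a',b',c',d')" by (cases h)
  have nz: "of_real c' * z + of_real d' \<noteq> 0"
    using autf_nonzero[OF assms] by (simp add: h)
  then show ?thesis
    by (simp add: g h distrib_right) (simp add: algebra_simps)
qed

lemma Im_moeb:
  assumes "mdet g = 1" "Im z > 0"
  shows "Im (moeb g z) > 0"
proof -
  obtain a b c d where g: "g = (a,b,c,d)" by (cases g)
  have nz: "of_real c * z + of_real d \<noteq> 0"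
    using autf_nonzero[OF assms] by (simp add: g)
  have "Im (moeb g z) = Im ((of_real a * z + of_real b) * cnj (of_real c * z + of_real d))
      / (cmod (of_real c * z + of_real d))\<^sup>2"
    unfolding g moeb.simps
    by (simp add: complex_div_cnj[of _ "of_real c * z + of_real d"] flip: of_real_power)
  also have "Im ((of_real a * z + of_real b) * cnj (of_real c * z + of_real d))
      = (a * d - b * c) * Im z"
    by (simp add: algebra_simps)
  finally show ?thesis
    using assms nz by (simp add: g)
qed

lemma moeb_minv_moeb:
  assumes "mdet g = 1" "Im z > 0"
  shows "moeb (minv g) (moeb g z) = z"
  using moeb_mmul[OF assms, of "minv g"] assms by (simp add: mmul_minv)

lemma minv_minv [simp]: "minv (minv g) = g"
  by (cases g) simp

lemma moeb_moeb_minv: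
  assumes "mdet g = 1" "Im z > 0"
  shows "moeb g (moeb (minv g) z) = z"
  using moeb_minv_moeb[of "minv g" z] assms by simp

lemma moeb_has_field_derivative:
  assumes "mdet g = 1" "Im z > 0"
  shows "(moeb g has_field_derivative 1 / autf g z ^ 2) (at z)"
proof -
  obtain a b c d where g: "g = (a,b,c,d)" by (cases g)
  have nz: "of_real c * z + of_real d \<noteq> 0"
    using autf_nonzero[OF assms] by (simp add: g)
  have eq: "moeb g = (\<lambda>z. (of_real a * z + of_real b) / (of_real c * z + of_real d))"
    by (auto simp: g)
  have "of_real (a * d - b * c) = (1::complex)"
    using assms(1) by (simp add: g)
  then have one: "of_real a * of_real d - of_real b * of_real c = (1::complex)"
    by simp
  have num: "of_real a * (of_real c * z + of_real d) - (of_real a * z + of_real b) * of_real c = 1"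
    using one by (simp add: algebra_simps)
  show ?thesis
    unfolding eq
    by (rule derivative_eq_intros refl nz)+ (use num in \<open>simp add: g power2_eq_square\<close>)
qed

lemma moeb_holomorphic: "mdet g = 1 \<Longrightarrow> moeb g holomorphic_on UHP"
  unfolding holomorphic_on_open[OF open_UHP]
  by (meson UHP_iff moeb_has_field_derivative)

text \<open>These are the imaginary and real parts of the fixed point equation. For \<open>c\<close>
  nonzero they determine both \<open>Re z\<close> and the absolute value of \<open>z\<close> from
  the matrix.\<close>

lemma moeb_fixed_coeffs:
  assumes "mdet (a,b,c,d) = 1" "Im z > 0" "moeb (a,b,c,d) z = z"
  shows "a - d = 2 * c * Re z" "b = - c * (Re z ^ 2 + Im z ^ 2)"
proof -
  have nz: "of_real c * z + of_real d \<noteq> 0"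
    using autf_nonzero[OF assms(1,2)] by simp
  have "of_real a * z + of_real b = z * (of_real c * z + of_real d)"
    using assms(3) nz by (simp add: divide_eq_eq)
  then have re: "a * Re z + b = Re z * (c * Re z + d) - Im z * (c * Im z)"
    and im: "a * Im z = Re z * (c * Im z) + Im z * (c * Re z + d)"
    by (auto simp: complex_eq_iff)
  from im have "Im z * (a - d) = Im z * (2 * c * Re z)"
    by (simp add: algebra_simps)
  then show 1: "a - d = 2 * c * Re z"
    using assms(2) by simp
  then have "a = d + 2 * c * Re z" by simp
  with re show "b = - c * (Re z ^ 2 + Im z ^ 2)"
    by (simp add: algebra_simps power2_eq_square)
qed

text \<open>At a fixed point the squared trace minus 4 equals -4 c^2 (Im z)^2. A trace of absolute
  value at least 2 thus forces c = 0, and the matrix is plus or minus the identity.\<close>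

lemma fixed_autf_sq_hyperbolic:
  assumes "mdet (a,b,c,d) = 1" "Im z > 0" "moeb (a,b,c,d) z = z" "(a + d)^2 \<ge> 4"
  shows "autf (a,b,c,d) z ^ 2 = 1"
proof -
  note co = moeb_fixed_coeffs[OF assms(1-3)]
  have "(a + d)^2 - 4 = (a - d)^2 + 4 * b * c"
    using assms(1) by (simp add: power2_eq_square algebra_simps)
  also have "\<dots> = - 4 * c^2 * Im z ^ 2"
    unfolding co by (simp add: power2_eq_square algebra_simps)
  finally have "c^2 * Im z ^ 2 \<le> 0"
    using assms(4) by simp
  then have "c = 0"
    using assms(2) by (simp add: mult_le_0_iff)
  with co assms(1) have "d ^ 2 = 1" by (simp add: power2_eq_square)
  with \<open>c = 0\<close> show ?thesis
    by simp (metis of_real_1 of_real_power)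
qed

text \<open>The first alternative is the scalar case c = 0; otherwise the coefficients determine the
  fixed point in the half plane.\<close>

lemma fixed_unique:
  assumes "mdet g = 1" "Im z > 0" "moeb g z = z" "Im w > 0" "moeb g w = w"
  shows "autf g z ^ 2 = 1 \<or> z = w"
proof -
  obtain a b c d where g: "g = (a,b,c,d)" by (cases g)
  note z = moeb_fixed_coeffs[OF assms(1-3)[unfolded g]]
  note w = moeb_fixed_coeffs[OF assms(1,4,5)[unfolded g]]
  show ?thesis
  proof (cases "c = 0")
    case True
    with z assms(1) have "d ^ 2 = 1" by (simp add: g power2_eq_square)
    with True show ?thesis
      by (simp add: g) (metis of_real_1 of_real_power)
  next
    case False
    with z w have "Re z = Re w" by simp
    with z w False have "Im z ^ 2 = Im w ^ 2" by simp
    then have "Im z = Im w" using assms by (simp add: power2_eq_iff)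
    with \<open>Re z = Re w\<close> show ?thesis by (simp add: complex_eq_iff)
  qed
qed

text \<open>Words are handled as matrices of determinant one, where the p-th power of
  \<open>A0 p\<close> is minus the identity; this negation tracks the sign that disappears in
  PSL2.\<close>

fun mneg :: "mat2 \<Rightarrow> mat2" where
  "mneg (a,b,c,d) = (-a,-b,-c,-d)"

lemma mneg_mneg [simp]: "mneg (mneg x) = x"
  by (cases x) simp

lemma mmul_mneg: "mmul (mneg x) y = mneg (mmul x y)" "mmul x (mneg y) = mneg (mmul x y)"
  by (cases x; cases y; simp)+

lemma moeb_mneg [simp]: "moeb (mneg x) z = moeb x z"
proof -
  obtain a b c d where x: "x = (a,b,c,d)" by (cases x)
  have "- (of_real a * z) - of_real b = - (of_real a * z + of_real b)"
    "- (of_real c * z) - of_real d = - (of_real c * z + of_real d)" by simp_all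
  then have "moeb (mneg x) z = - (of_real a * z + of_real b) / - (of_real c * z + of_real d)"
    unfolding x by simp
  then show ?thesis
    by (simp only: x moeb.simps minus_divide_left[symmetric] minus_divide_right[symmetric] minus_minus)
qed

lemma autf_mneg [simp]: "autf (mneg x) z = - autf x z"
  by (cases x) simp

fun mpow :: "mat2 \<Rightarrow> nat \<Rightarrow> mat2" where
  "mpow x 0 = mat_id"
| "mpow x (Suc n) = mmul x (mpow x n)"

lemma mpow_add: "mpow x (m + n) = mmul (mpow x m) (mpow x n)"
  by (induction m) (simp_all add: mmul_assoc)

lemma mdet_mpow: "mdet x = 1 \<Longrightarrow> mdet (mpow x n) = 1"
  by (induction n) (simp_all add: mdet_mmul)

lemma moeb_mpow_fixed:
  assumes "mdet x = 1" "Im z > 0" "moeb x z = z"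
  shows "moeb (mpow x n) z = z" "autf (mpow x n) z = autf x z ^ n"
  using assms by (induction n) (simp_all add: moeb_mmul autf_mmul mdet_mpow, simp add: mat_id_def)

lemma mdet_A0 [simp]: "mdet (A0 p) = 1" and mdet_B0 [simp]: "mdet (B0 q) = 1"
  by (simp_all add: A0_def B0_def)

lemma sin_pi_div_pos:
  assumes "2 \<le> (p::nat)"
  shows "sin (pi / p) > 0"
proof (rule sin_gt_zero)
  show "pi / real p < pi" using assms by (simp add: field_simps)
qed (use assms in simp)

lemma sin_add_twice: "sin (x + 2 * t) = 2 * cos t * sin (x + t) - sin (x::real)"
proof -
  have "sin (x + 2 * t) + sin x = 2 * cos t * sin (x + t)"
    using sin_plus_sin[of "x + 2 * t" x] by (simp add: add_divide_distrib)
  then show ?thesis by simp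
qed

text \<open>The entries are Chebyshev polynomials of the second kind at cos t. Their three-term
  recurrence is \<open>sin_add_twice\<close>, whose coefficient 2 cos t is the trace of
  \<open>A0 p\<close>.\<close>

lemma mpow_A0:
  assumes "2 \<le> p"
  defines "t \<equiv> pi / real p"
  shows "mpow (A0 p) k = (sin (k * t + t) / sin t, sin (k * t) / sin t,
                          - (sin (k * t) / sin t), - (sin (k * t - t) / sin t))"
proof (induction k)
  case 0
  then show ?case
    using sin_pi_div_pos[OF assms(1)] by (simp add: mat_id_def t_def)
next
  case (Suc k)
  have s: "sin t > 0"
    using sin_pi_div_pos[OF assms(1)] by (simp add: t_def)
  show ?case
    using sin_add_twice[of "k * t" t] sin_add_twice[of "k * t - t" t] s
    by (simp add: Suc) (simp add: A0_def add_ac diff_divide_distrib distrib_right distrib_left right_diff_distrib flip: t_def)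
qed

lemma mpow_B0:
  assumes "2 \<le> q"
  defines "t \<equiv> pi / real q"
  shows "mpow (B0 q) k = (- (sin (k * t - t) / sin t), sin (k * t) / sin t,
                          - (sin (k * t) / sin t), sin (k * t + t) / sin t)"
proof (induction k)
  case 0
  then show ?case
    using sin_pi_div_pos[OF assms(1)] by (simp add: mat_id_def t_def)
next
  case (Suc k)
  have s: "sin t > 0"
    using sin_pi_div_pos[OF assms(1)] by (simp add: t_def)
  show ?case
    using sin_add_twice[of "k * t" t] sin_add_twice[of "k * t - t" t] s
    by (simp add: Suc) (simp add: B0_def add_ac diff_divide_distrib distrib_right distrib_left right_diff_distrib flip: t_def)
qed

lemma mpow_A0_period:
  assumes "2 \<le> p"
  shows "mpow (A0 p) p = mneg mat_id"
  using sin_pi_div_pos[OF assms] assms unfolding mpow_A0[OF assms]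
  by (simp add: mat_id_def sin_add sin_diff)

lemma mpow_B0_period:
  assumes "2 \<le> q"
  shows "mpow (B0 q) q = mneg mat_id"
  using sin_pi_div_pos[OF assms] assms unfolding mpow_B0[OF assms]
  by (simp add: mat_id_def sin_add sin_diff)

section \<open>Sign patterns that force a large trace\<close>

text \<open>Conjugation by \<open>diag(1,-1)\<close> turns these, up to a global sign, into the matrices with
  nonnegative entries.\<close>

definition hyp_sign :: "mat2 \<Rightarrow> bool" where
  "hyp_sign = (\<lambda>(a,b,c,d). (a \<ge> 0 \<and> d \<ge> 0 \<and> b \<le> 0 \<and> c \<le> 0) \<or> (a \<le> 0 \<and> d \<le> 0 \<and> b \<ge> 0 \<and> c \<ge> 0))"

lemma hyp_sign_mmul:
  assumes "hyp_sign x" "hyp_sign y"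
  shows "hyp_sign (mmul x y)"
proof -
  obtain a b c d where x: "x = (a,b,c,d)" by (cases x)
  obtain a' b' c' d' where y: "y = (a',b',c',d')" by (cases y)
  have "(a*a' \<ge> 0 \<and> b*c' \<ge> 0 \<and> a*b' \<le> 0 \<and> b*d' \<le> 0 \<and> c*a' \<le> 0 \<and> d*c' \<le> 0 \<and> c*b' \<ge> 0 \<and> d*d' \<ge> 0)
    \<or> (a*a' \<le> 0 \<and> b*c' \<le> 0 \<and> a*b' \<ge> 0 \<and> b*d' \<ge> 0 \<and> c*a' \<ge> 0 \<and> d*c' \<ge> 0 \<and> c*b' \<le> 0 \<and> d*d' \<le> 0)"
    using assms unfolding x y hyp_sign_def prod.case
    by (elim disjE) (simp_all add: zero_le_mult_iff mult_le_0_iff)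
  then show ?thesis
    unfolding x y mmul.simps hyp_sign_def prod.case by linarith
qed

lemma hyp_sign_trace:
  assumes "hyp_sign (a,b,c,d)" "mdet (a,b,c,d) = 1"
  shows "(a + d)^2 \<ge> 4"
proof -
  have "b * c \<ge> 0"
    using assms(1) by (auto simp: hyp_sign_def mult_nonneg_nonneg mult_nonpos_nonpos)
  then have "a * d \<ge> 1" using assms(2) by simp
  moreover have "(a + d)^2 = (a - d)^2 + 4 * (a * d)"
    by (simp add: power2_eq_square algebra_simps)
  ultimately show ?thesis
    by (smt (verit) zero_le_power2)
qed

lemma sin_mult_nonneg:
  assumes "2 \<le> (p::nat)" "0 \<le> x" "x \<le> p"
  shows "sin (x * (pi / p)) \<ge> 0"
proof (rule sin_ge_zero)
  show "x * (pi / p) \<le> pi" using assms by (simp add: field_simps)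
qed (use assms in simp)

text \<open>For exponents strictly between 0 and the order, even the outer angles (k - 1) t and (k +
  1) t lie in [0, pi], so all the sines are nonnegative. The factors then have signs (+,+,-,-) and
  (-,+,-,+), and no cancellation occurs in the product.\<close>

lemma hyp_sign_AB:
  assumes "2 \<le> p" "2 \<le> q" "0 < k" "k < p" "0 < l" "l < q"
  shows "hyp_sign (mmul (mpow (A0 p) k) (mpow (B0 q) l))"
proof -
  define s where "s = pi / real p"
  define t where "t = pi / real q"
  have "sin s > 0" "sin t > 0"
    using sin_pi_div_pos[OF assms(1)] sin_pi_div_pos[OF assms(2)] by (auto simp: s_def t_def)
  moreover have "sin (k * s + s) \<ge> 0" "sin (k * s) \<ge> 0" "sin (k * s - s) \<ge> 0"
    using sin_mult_nonneg[OF assms(1), of "k + 1"] sin_mult_nonneg[OF assms(1), of "k"]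
      sin_mult_nonneg[OF assms(1), of "real k - 1"] assms
    by (auto simp: s_def algebra_simps add_divide_distrib diff_divide_distrib)
  moreover have "sin (l * t + t) \<ge> 0" "sin (l * t) \<ge> 0" "sin (l * t - t) \<ge> 0"
    using sin_mult_nonneg[OF assms(2), of "l + 1"] sin_mult_nonneg[OF assms(2), of "l"]
      sin_mult_nonneg[OF assms(2), of "real l - 1"] assms
    by (auto simp: t_def algebra_simps add_divide_distrib diff_divide_distrib)
  ultimately show ?thesis
    unfolding mpow_A0[OF assms(1)] mpow_B0[OF assms(2)] s_def[symmetric] t_def[symmetric]
      hyp_sign_def mmul.simps prod.case
    by (intro disjI2 conjI add_nonneg_nonneg add_nonpos_nonpos)
       (simp_all add: zero_le_mult_iff mult_le_0_iff)
qed

section \<open>Words in the generators of the triangle group\<close>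

abbreviation (input) fixA :: "nat \<Rightarrow> complex" where
  "fixA p \<equiv> Complex (- cos (pi / real p)) (sin (pi / real p))"

abbreviation (input) fixB :: "nat \<Rightarrow> complex" where
  "fixB q \<equiv> Complex (cos (pi / real q)) (sin (pi / real q))"

lemma Im_fix:
  assumes "2 \<le> n"
  shows "Im (fixA n) > 0" "Im (fixB n) > 0"
  using sin_pi_div_pos[OF assms] by simp_all

lemma autf_fixA: "autf (A0 p) (fixA p) = cis (- (pi / p))"
  by (simp add: A0_def complex_eq_iff)

lemma autf_fixB: "autf (B0 q) (fixB q) = cis (- (pi / q))"
  by (simp add: B0_def complex_eq_iff)

lemma cis_pi_div_power:
  assumes "2 \<le> n"
  shows "cis (- (pi / real n)) ^ (2 * n) = 1"
proof -
  have "cis (- (pi / real n)) ^ (2 * n) = cis (- (2 * pi))"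
    using assms unfolding Complex.DeMoivre by (simp add: field_simps)
  then show ?thesis by (simp add: complex_eq_iff)
qed

lemma moeb_fixA: "moeb (A0 p) (fixA p) = fixA p"
proof -
  have "of_real (2 * cos (pi / p)) * fixA p + 1 = fixA p * autf (A0 p) (fixA p)"
    unfolding autf_fixA using sin_cos_squared_add3[of "pi / p"]
    by (simp add: complex_eq_iff algebra_simps)
  moreover have "moeb (A0 p) (fixA p) = (of_real (2 * cos (pi / p)) * fixA p + 1) / autf (A0 p) (fixA p)"
    by (simp add: A0_def)
  moreover have "autf (A0 p) (fixA p) \<noteq> 0"
    unfolding autf_fixA by simp
  ultimately show ?thesis
    by simp
qed

lemma moeb_fixB: "moeb (B0 q) (fixB q) = fixB q"
proof -
  have "1 = fixB q * autf (B0 q) (fixB q)"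
    unfolding autf_fixB using sin_cos_squared_add3[of "pi / q"]
    by (simp add: complex_eq_iff algebra_simps)
  moreover have "moeb (B0 q) (fixB q) = 1 / autf (B0 q) (fixB q)"
    by (simp add: B0_def)
  moreover have "autf (B0 q) (fixB q) \<noteq> 0"
    unfolding autf_fixB by simp
  ultimately show ?thesis
    by (simp add: divide_eq_eq)
qed

lemma mgen_mmul: "g \<in> mgen S \<Longrightarrow> h \<in> mgen S \<Longrightarrow> mmul g h \<in> mgen S"
  by (induction rule: mgen.induct) (simp_all add: mmul_assoc mgen.intros)

lemma mgen_base: "s \<in> S \<Longrightarrow> s \<in> mgen S"
  using mgen_l[OF _ mgen_id] by simp

lemma mgen_mpow: "g \<in> mgen S \<Longrightarrow> mpow g n \<in> mgen S"
  by (induction n) (simp_all add: mgen_mmul mgen_id)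

lemma mdet_Gamma: "g \<in> Gamma_pq p q \<Longrightarrow> mdet g = 1"
  unfolding Gamma_pq_def by (induction rule: mgen.induct) (auto simp: mdet_mmul)

lemma minv_mmul: "minv (mmul g h) = mmul (minv h) (minv g)"
  by (cases g; cases h) (simp add: algebra_simps)

lemma mgen_minv: "g \<in> mgen S \<Longrightarrow> minv g \<in> mgen S"
proof (induction rule: mgen.induct)
  case mgen_id
  then show ?case
    using mgen.mgen_id by (simp add: mat_id_def)
next
  case (mgen_l s g)
  have "minv s \<in> mgen S"
    using mgen.mgen_li[OF mgen_l(1) mgen.mgen_id] by simp
  with mgen_l show ?case by (simp add: minv_mmul mgen_mmul)
next
  case (mgen_li s g)
  then show ?case by (simp add: minv_mmul mgen_mmul mgen_base)
qed

lemma A0_Gamma: "A0 p \<in> Gamma_pq p q" and B0_Gamma: "B0 q \<in> Gamma_pq p q"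
  by (simp_all add: Gamma_pq_def mgen_base)

lemma Gamma_mmul: "g \<in> Gamma_pq p q \<Longrightarrow> h \<in> Gamma_pq p q \<Longrightarrow> mmul g h \<in> Gamma_pq p q"
  by (simp add: Gamma_pq_def mgen_mmul)

lemma Gamma_mpow: "g \<in> Gamma_pq p q \<Longrightarrow> mpow g n \<in> Gamma_pq p q"
  by (simp add: Gamma_pq_def mgen_mpow)

lemma Gamma_minv: "g \<in> Gamma_pq p q \<Longrightarrow> minv g \<in> Gamma_pq p q"
  by (simp add: Gamma_pq_def mgen_minv)

section \<open>Normal forms of words in the two generators\<close>

locale triangle =
  fixes p q :: nat
  assumes p2: "2 \<le> p" and q2: "2 \<le> q"
begin

abbreviation "A \<equiv> A0 p"
abbreviation "B \<equiv> B0 q"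
abbreviation "\<Gamma> \<equiv> Gamma_pq p q"

primrec altword :: "(nat \<times> nat) list \<Rightarrow> mat2" where
  "altword [] = mat_id"
| "altword (x # xs) = mmul (mmul (mpow A (fst x)) (mpow B (snd x))) (altword xs)"

definition reduced :: "(nat \<times> nat) list \<Rightarrow> bool" where
  "reduced xs \<longleftrightarrow> (\<forall>(k,l)\<in>set xs. 0 < k \<and> k < p \<and> 0 < l \<and> l < q)"

text \<open>An alternating word is cut into blocks A^k B^l because each block has the sign pattern
  \<open>hyp_sign\<close>. A power of B in front and a power of A at the end remain
  unpaired.\<close>

definition normal_word :: "nat \<Rightarrow> (nat \<times> nat) list \<Rightarrow> nat \<Rightarrow> mat2" where
  "normal_word j xs i = mmul (mpow B j) (mmul (altword xs) (mpow A i))"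

definition normal_forms :: "mat2 set" where
  "normal_forms = {g. \<exists>j xs i. j < q \<and> i < p \<and> reduced xs \<and>
     (g = normal_word j xs i \<or> g = mneg (normal_word j xs i))}"

lemma altword_append: "altword (xs @ ys) = mmul (altword xs) (altword ys)"
  by (induction xs) (simp_all add: mmul_assoc)

lemma normal_wordI:
  "j < q \<Longrightarrow> i < p \<Longrightarrow> reduced xs \<Longrightarrow> normal_word j xs i \<in> normal_forms"
  unfolding normal_forms_def by blast

lemma normal_forms_mneg: "g \<in> normal_forms \<Longrightarrow> mneg g \<in> normal_forms"
  unfolding normal_forms_def using mneg_mneg by blast

lemma mpow_A_reduce: "p \<le> n \<Longrightarrow> mpow A n = mneg (mpow A (n - p))"
  using mpow_add[of A p "n - p"] mpow_A0_period[OF p2] by (simp add: mmul_mneg)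

lemma mpow_B_reduce: "q \<le> n \<Longrightarrow> mpow B n = mneg (mpow B (n - q))"
  using mpow_add[of B q "n - q"] mpow_B0_period[OF q2] by (simp add: mmul_mneg)

text \<open>If the leading power of B is nontrivial, the new A opens a block with it. Otherwise A
  merges with the first block, or with the trailing power if there is no block. When the exponent of
  the block reaches p, its A-part becomes a sign and its B-part becomes the new leading
  power.\<close>

lemma A_normal_word:
  assumes "j < q" "i < p" "reduced xs"
  shows "mmul A (normal_word j xs i) \<in> normal_forms"
proof (cases "j = 0")
  case False
  have "mmul A (normal_word j xs i) = normal_word 0 ((1, j) # xs) i"
    by (simp add: normal_word_def mmul_assoc)
  moreover have "reduced ((1, j) # xs)"
    using assms p2 False by (auto simp: reduced_def)
  ultimately show ?thesis
    using normal_wordI assms by force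
next
  case True
  show ?thesis
  proof (cases xs)
    case Nil
    have eq: "mmul A (normal_word j xs i) = mpow A (Suc i)"
      using True Nil by (simp add: normal_word_def)
    show ?thesis
    proof (cases "Suc i < p")
      case True
      have "mpow A (Suc i) = normal_word 0 [] (Suc i)" by (simp add: normal_word_def)
      then show ?thesis unfolding eq using normal_wordI[of 0 "Suc i" "[]"] True assms
        by (simp add: reduced_def)
    next
      case False
      then have "mpow A (Suc i) = mneg (normal_word 0 [] 0)"
        using assms mpow_A_reduce[of "Suc i"] by (simp add: normal_word_def del: mpow.simps(2))
      then show ?thesis unfolding eq using normal_wordI[of 0 0 "[]"] assms
        by (simp add: reduced_def normal_forms_mneg)
    qed
  next
    case (Cons x ys)
    obtain k l where x: "x = (k, l)" by (cases x)
    have kl: "0 < k" "k < p" "0 < l" "l < q" and ys: "reduced ys"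
      using assms(3) by (auto simp: reduced_def Cons x)
    have eq: "mmul A (normal_word j xs i)
        = mmul (mpow A (Suc k)) (mmul (mpow B l) (mmul (altword ys) (mpow A i)))"
      by (simp add: normal_word_def True Cons x mmul_assoc)
    show ?thesis
    proof (cases "Suc k < p")
      case True
      have "reduced ((Suc k, l) # ys)" using kl ys True by (simp add: reduced_def)
      moreover have "mmul A (normal_word j xs i) = normal_word 0 ((Suc k, l) # ys) i"
        unfolding eq by (simp add: normal_word_def mmul_assoc)
      ultimately show ?thesis using normal_wordI assms by force
    next
      case False
      then have "mpow A (Suc k) = mneg mat_id"
        using kl mpow_A_reduce[of "Suc k"] by (simp del: mpow.simps(2))
      then have "mmul A (normal_word j xs i) = mneg (normal_word l ys i)"
        unfolding eq by (simp add: normal_word_def mmul_mneg)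
      then show ?thesis using normal_wordI[OF kl(4) assms(2) ys]
        by (simp add: normal_forms_mneg)
    qed
  qed
qed

lemma B_normal_word:
  assumes "j < q" "i < p" "reduced xs"
  shows "mmul B (normal_word j xs i) \<in> normal_forms"
proof -
  have eq: "mmul B (normal_word j xs i) = mmul (mpow B (Suc j)) (mmul (altword xs) (mpow A i))"
    by (simp add: normal_word_def mmul_assoc)
  show ?thesis
  proof (cases "Suc j < q")
    case True
    then show ?thesis
      unfolding eq using normal_wordI[OF True assms(2,3)] by (simp add: normal_word_def)
  next
    case False
    then have "mpow B (Suc j) = mneg mat_id"
      using assms mpow_B_reduce[of "Suc j"] by (simp del: mpow.simps(2))
    then have "mmul B (normal_word j xs i) = mneg (normal_word 0 xs i)"
      unfolding eq by (simp add: normal_word_def mmul_mneg)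
    then show ?thesis
      using normal_wordI[of 0 i xs] assms by (simp add: normal_forms_mneg)
  qed
qed

lemma AB_normal_forms:
  assumes "g \<in> normal_forms"
  shows "mmul A g \<in> normal_forms" "mmul B g \<in> normal_forms"
proof -
  obtain j xs i where "j < q" "i < p" "reduced xs"
    and g: "g = normal_word j xs i \<or> g = mneg (normal_word j xs i)"
    using assms unfolding normal_forms_def by blast
  then have "mmul A (normal_word j xs i) \<in> normal_forms" "mmul B (normal_word j xs i) \<in> normal_forms"
    using A_normal_word B_normal_word by blast+
  then show "mmul A g \<in> normal_forms" "mmul B g \<in> normal_forms"
    using g by (auto simp: mmul_mneg normal_forms_mneg)
qed

lemma mpow_normal_forms:
  assumes "g \<in> normal_forms"
  shows "mmul (mpow A n) g \<in> normal_forms" "mmul (mpow B n) g \<in> normal_forms"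
  by (induction n) (simp_all add: assms mmul_assoc AB_normal_forms)

text \<open>Inverse generators are negated positive powers, so closure of
  \<open>normal_forms\<close> under left multiplication by \<open>A\<close> and \<open>B\<close> is
  all that a treatment of the whole group requires.\<close>

lemma minv_eq_mneg_mpow:
  assumes "mpow s n = mneg mat_id" "mdet s = 1" "0 < n"
  shows "minv s = mneg (mpow s (n - 1))"
proof -
  have "mmul s (mpow s (n - 1)) = mneg mat_id"
    using assms by (cases n) auto
  then have "mmul (minv s) (mmul s (mpow s (n - 1))) = mneg (minv s)"
    by (simp add: mmul_mneg)
  then have "mpow s (n - 1) = mneg (minv s)"
    using assms by (simp add: mmul_minv flip: mmul_assoc)
  then show ?thesis by simp
qed

lemma Gamma_normal_forms:
  assumes "g \<in> \<Gamma>"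
  shows "g \<in> normal_forms"
  using assms unfolding Gamma_pq_def
proof (induction rule: mgen.induct)
  case mgen_id
  have "normal_word 0 [] 0 = mat_id" by (simp add: normal_word_def)
  then show ?case using normal_wordI[of 0 0 "[]"] p2 q2 by (simp add: reduced_def)
next
  case (mgen_l s g)
  then show ?case by (auto intro: AB_normal_forms)
next
  case (mgen_li s g)
  have "minv A = mneg (mpow A (p - 1))" "minv B = mneg (mpow B (q - 1))"
    using p2 q2 minv_eq_mneg_mpow[OF mpow_A0_period mdet_A0] minv_eq_mneg_mpow[OF mpow_B0_period mdet_B0]
    by auto
  with mgen_li show ?case
    by (auto simp: mmul_mneg intro!: normal_forms_mneg mpow_normal_forms)
qed

lemma countable_Gamma: "countable \<Gamma>"
proof -
  have "\<Gamma> \<subseteq> (\<lambda>(e, j, xs, i). if e then normal_word j xs i else mneg (normal_word j xs i)) ` UNIV"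
  proof
    fix g assume "g \<in> \<Gamma>"
    then obtain j xs i where "g = normal_word j xs i \<or> g = mneg (normal_word j xs i)"
      using Gamma_normal_forms unfolding normal_forms_def by blast
    then show "g \<in> (\<lambda>(e, j, xs, i). if e then normal_word j xs i else mneg (normal_word j xs i)) ` UNIV"
    proof
      assume "g = normal_word j xs i"
      then show ?thesis by (intro image_eqI[where x = "(True, j, xs, i)"]) auto
    next
      assume "g = mneg (normal_word j xs i)"
      then show ?thesis by (intro image_eqI[where x = "(False, j, xs, i)"]) auto
    qed
  qed
  then show ?thesis
    by (rule countable_subset) simp
qed

lemma mpow_A_Gamma: "mpow A n \<in> \<Gamma>" and mpow_B_Gamma: "mpow B n \<in> \<Gamma>"
  by (simp_all add: Gamma_mpow A0_Gamma B0_Gamma)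

lemma altword_Gamma: "altword xs \<in> \<Gamma>"
  by (induction xs) (auto simp: Gamma_mmul mpow_A_Gamma mpow_B_Gamma, simp add: Gamma_pq_def mgen_id)

lemma altword_hyp_sign: "reduced xs \<Longrightarrow> hyp_sign (altword xs)"
proof (induction xs)
  case Nil
  then show ?case by (simp add: hyp_sign_def mat_id_def)
next
  case (Cons x xs)
  then have "hyp_sign (mmul (mpow A (fst x)) (mpow B (snd x)))"
    by (intro hyp_sign_AB) (auto simp: reduced_def p2 q2)
  with Cons show ?case by (auto simp: reduced_def intro: hyp_sign_mmul)
qed

end

section \<open>Multipliers at fixed points by cyclic reduction\<close>

locale triangle_invariant = triangle +
  fixes \<theta> :: "complex \<Rightarrow> complex"
  assumes inv: "\<And>g z. g \<in> \<Gamma> \<Longrightarrow> Im z > 0 \<Longrightarrow> \<theta> (moeb g z) = \<theta> z"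
    and theta_fixA: "\<theta> (fixA p) = 0" and theta_fixB: "\<theta> (fixB q) = 1"
begin

text \<open>The multiplier of \<open>g\<close> at a fixed point is \<open>autf g z\<close> to the power -2; even exponents make
  the condition insensitive to the sign of the matrix. For words that are cyclic rotations of each other
  the condition is equivalent, which allows cyclic reduction.\<close>

definition tame :: "mat2 \<Rightarrow> bool" where
  "tame g \<longleftrightarrow> (\<forall>z. Im z > 0 \<longrightarrow> moeb g z = z \<longrightarrow>
     autf g z ^ 2 = 1 \<or> \<theta> z = 0 \<and> autf g z ^ (2 * p) = 1 \<or> \<theta> z = 1 \<and> autf g z ^ (2 * q) = 1)"

lemma tame_mneg: "tame (mneg g) \<longleftrightarrow> tame g"
  by (simp add: tame_def)

text \<open>The two products are conjugate by \<open>g\<close>: fixed points correspond under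
  \<open>moeb g\<close>, with the same value of \<open>\<theta>\<close>, and the cocycle rule gives
  equal automorphy factors.\<close>

lemma tame_commute:
  assumes "g \<in> \<Gamma>" "h \<in> \<Gamma>" "tame (mmul g h)"
  shows "tame (mmul h g)"
  unfolding tame_def
proof (intro allI impI)
  fix z assume z: "Im z > 0" "moeb (mmul h g) z = z"
  have dg: "mdet g = 1" and dh: "mdet h = 1"
    using assms mdet_Gamma by auto
  define w where "w = moeb g z"
  have w: "Im w > 0" using Im_moeb dg z by (simp add: w_def)
  have hw: "moeb h w = z" using moeb_mmul[OF dg z(1)] z(2) by (simp add: w_def)
  have "moeb (mmul g h) w = w"
    using moeb_mmul[OF dh w] hw by (simp add: w_def)
  moreover have "autf (mmul h g) z = autf (mmul g h) w"
    using autf_mmul[OF dg z(1)] autf_mmul[OF dh w] hw by (simp add: w_def)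
  moreover have "\<theta> w = \<theta> z" using inv assms z by (simp add: w_def)
  ultimately show "autf (mmul h g) z ^ 2 = 1 \<or> \<theta> z = 0 \<and> autf (mmul h g) z ^ (2 * p) = 1
     \<or> \<theta> z = 1 \<and> autf (mmul h g) z ^ (2 * q) = 1"
    using assms(3) w unfolding tame_def by metis
qed

lemma tame_hyp_sign:
  assumes "hyp_sign g" "mdet g = 1"
  shows "tame g"
proof -
  obtain a b c d where g: "g = (a,b,c,d)" by (cases g)
  show ?thesis
    unfolding tame_def g
    using assms hyp_sign_trace fixed_autf_sq_hyperbolic unfolding g by blast
qed

lemma tame_altword: "reduced xs \<Longrightarrow> tame (altword xs)"
  using altword_hyp_sign altword_Gamma mdet_Gamma tame_hyp_sign by blast

text \<open>By \<open>fixed_unique\<close>, a power of \<open>A\<close> that is not plus or minus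
  the identity fixes only \<open>fixA p\<close>, and there its automorphy factor is a power of cis
  (- pi / p).\<close>

lemma tame_mpow_A: "tame (mpow A n)"
  unfolding tame_def
proof (intro allI impI)
  fix z assume z: "Im z > 0" "moeb (mpow A n) z = z"
  note f = moeb_mpow_fixed[OF mdet_A0 Im_fix(1)[OF p2] moeb_fixA, of n]
  have "autf (mpow A n) (fixA p) ^ (2 * p) = (cis (- (pi / p)) ^ (2 * p)) ^ n"
    unfolding f autf_fixA by (simp add: mult.commute flip: power_mult)
  then have "autf (mpow A n) (fixA p) ^ (2 * p) = 1"
    using p2 by (simp add: cis_pi_div_power)
  then show "autf (mpow A n) z ^ 2 = 1 \<or> \<theta> z = 0 \<and> autf (mpow A n) z ^ (2 * p) = 1
     \<or> \<theta> z = 1 \<and> autf (mpow A n) z ^ (2 * q) = 1"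
    using fixed_unique[OF mdet_mpow[OF mdet_A0] z Im_fix(1)[OF p2] f(1)] theta_fixA by metis
qed

lemma tame_mpow_B: "tame (mpow B n)"
  unfolding tame_def
proof (intro allI impI)
  fix z assume z: "Im z > 0" "moeb (mpow B n) z = z"
  note f = moeb_mpow_fixed[OF mdet_B0 Im_fix(2)[OF q2] moeb_fixB, of n]
  have "autf (mpow B n) (fixB q) ^ (2 * q) = (cis (- (pi / q)) ^ (2 * q)) ^ n"
    unfolding f autf_fixB by (simp add: mult.commute flip: power_mult)
  then have "autf (mpow B n) (fixB q) ^ (2 * q) = 1"
    using q2 by (simp add: cis_pi_div_power)
  then show "autf (mpow B n) z ^ 2 = 1 \<or> \<theta> z = 0 \<and> autf (mpow B n) z ^ (2 * p) = 1
     \<or> \<theta> z = 1 \<and> autf (mpow B n) z ^ (2 * q) = 1"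
    using fixed_unique[OF mdet_mpow[OF mdet_B0] z Im_fix(2)[OF q2] f(1)] theta_fixB by metis
qed

lemma tame_AB_altword:
  assumes "0 < k" "k < p" "0 < l" "l < q" "reduced xs"
  shows "tame (mmul (mpow A k) (mmul (mpow B l) (altword xs)))"
  using tame_altword[of "(k, l) # xs"] assms by (simp add: reduced_def mmul_assoc)

text \<open>Rotating the last B^l of the word to the front merges it with B^j. If the exponents
  cancel, the shorter word is left with a trailing power of A, which belongs to the other half of
  the claim; symmetrically for A^i. Hence both halves are proved in one induction on the
  length.\<close>

lemma tame_one_sided:
  assumes "reduced xs"
  shows "(\<forall>j<q. tame (mmul (mpow B j) (altword xs))) \<and> (\<forall>i<p. tame (mmul (altword xs) (mpow A i)))"
  using assms
proof (induction "length xs" arbitrary: xs rule: less_induct)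
  case less
  note G = Gamma_mmul mpow_A_Gamma mpow_B_Gamma altword_Gamma
  show ?case
  proof (intro conjI allI impI)
    fix j assume j: "j < q"
    show "tame (mmul (mpow B j) (altword xs))"
    proof (cases "j = 0 \<or> xs = []")
      case True
      then show ?thesis using tame_altword[OF less.prems] tame_mpow_B by auto
    next
      case False
      then obtain ys x where xs: "xs = ys @ [x]" by (metis rev_exhaust)
      obtain k l where x: "x = (k, l)" by (cases x)
      have kl: "0 < k" "k < p" "0 < l" "l < q" and ys: "reduced ys"
        using less.prems by (auto simp: reduced_def xs x)
      have "tame (mmul (mpow B (l + j)) (mmul (altword ys) (mpow A k)))"
      proof (cases "l + j = q")
        case True
        then show ?thesis
          using less.hyps[OF _ ys] kl by (simp add: xs mpow_B0_period[OF q2] mmul_mneg tame_mneg)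
      next
        case neq: False
        \<comment> \<open>Rotating A^k to the front pairs it with B^m, and the result is a product
          of complete blocks.\<close>
        have gen: "tame (mmul (mpow B m) (mmul (altword ys) (mpow A k)))" if "0 < m" "m < q" for m
        proof -
          have "tame (mmul (mmul (mpow B m) (altword ys)) (mpow A k))"
            by (rule tame_commute) (use that kl ys in \<open>simp_all add: G tame_AB_altword\<close>)
          then show ?thesis by (simp add: mmul_assoc)
        qed
        show ?thesis
        proof (cases "l + j < q")
          case True
          then show ?thesis using gen[of "l + j"] False by simp
        next
          case ge: False
          then show ?thesis
            using gen[of "l + j - q"] neq j kl by (simp add: mpow_B_reduce[of "l + j"] mmul_mneg tame_mneg)
        qed
      qed
      then have "tame (mmul (mpow B l) (mmul (mpow B j) (mmul (altword ys) (mpow A k))))"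
        by (simp add: mpow_add mmul_assoc)
      then have "tame (mmul (mmul (mpow B j) (mmul (altword ys) (mpow A k))) (mpow B l))"
        by (rule tame_commute[rotated 2]) (simp_all add: G)
      then show ?thesis
        by (simp add: xs x altword_append mmul_assoc)
    qed
  next
    fix i assume i: "i < p"
    show "tame (mmul (altword xs) (mpow A i))"
    proof (cases "i = 0 \<or> xs = []")
      case True
      then show ?thesis using tame_altword[OF less.prems] tame_mpow_A by auto
    next
      case False
      then obtain x ys where xs: "xs = x # ys" by (metis list.exhaust)
      obtain k l where x: "x = (k, l)" by (cases x)
      have kl: "0 < k" "k < p" "0 < l" "l < q" and ys: "reduced ys"
        using less.prems by (auto simp: reduced_def xs x)
      have "tame (mmul (mpow A (i + k)) (mmul (mpow B l) (altword ys)))"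
      proof (cases "i + k = p")
        case True
        then show ?thesis
          using less.hyps[OF _ ys] kl by (simp add: xs mpow_A0_period[OF p2] mmul_mneg tame_mneg)
      next
        case neq: False
        note gen = tame_AB_altword[OF _ _ kl(3,4) ys]
        show ?thesis
        proof (cases "i + k < p")
          case True
          then show ?thesis using gen[of "i + k"] False by simp
        next
          case ge: False
          then show ?thesis
            using gen[of "i + k - p"] neq i kl by (simp add: mpow_A_reduce[of "i + k"] mmul_mneg tame_mneg)
        qed
      qed
      then have "tame (mmul (mpow A i) (altword xs))"
        by (simp add: xs x mpow_add mmul_assoc)
      then show ?thesis
        by (rule tame_commute[rotated 2]) (simp_all add: G)
    qed
  qed
qed

lemma tame_Gamma:
  assumes "g \<in> \<Gamma>"
  shows "tame g"
proof -
  note G = Gamma_mmul mpow_A_Gamma mpow_B_Gamma altword_Gamma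
  from Gamma_normal_forms[OF assms] obtain j xs i where
    "j < q" "i < p" "reduced xs" and g: "g = normal_word j xs i \<or> g = mneg (normal_word j xs i)"
    unfolding normal_forms_def by blast
  \<comment> \<open>Rotated cyclically, the two unpaired ends meet: if both are nontrivial they form
    one more block, otherwise the word is one-sided.\<close>
  have "tame (mmul (mpow A i) (mmul (mpow B j) (altword xs)))"
  proof (cases "i = 0 \<or> j = 0")
    case True
    have "tame (mmul (mpow A i) (altword xs))"
      by (rule tame_commute) (use tame_one_sided[of xs] \<open>i < p\<close> \<open>reduced xs\<close> in \<open>simp_all add: G\<close>)
    then show ?thesis
      using True tame_one_sided[OF \<open>reduced xs\<close>] \<open>j < q\<close> by auto
  next
    case False
    then show ?thesis
      using tame_AB_altword \<open>i < p\<close> \<open>j < q\<close> \<open>reduced xs\<close> by simp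
  qed
  then have "tame (mmul (mmul (mpow B j) (altword xs)) (mpow A i))"
    by (rule tame_commute[rotated 2]) (simp_all add: G)
  then show ?thesis
    using g by (auto simp: normal_word_def mmul_assoc tame_mneg)
qed

end

section \<open>Ramification\<close>

lemma root_of_unity_power_eq_1:
  fixes n k :: nat
  assumes "0 < n"
  shows "exp (2 * of_real pi * \<i> / of_nat n) ^ k = 1 \<longleftrightarrow> n dvd k"
proof -
  have "exp (2 * of_real pi * \<i> / of_nat n) ^ k = exp (2 * of_real pi * \<i> * of_nat k / of_nat n)"
    by (simp add: mult_ac flip: exp_of_nat_mult)
  then show ?thesis
    using complex_root_unity_eq_1[of n k] assms by simp
qed

text \<open>The left side is the derivative of a generator at its fixed point, computed from the
  automorphy factor; it is a primitive n-th root of unity.\<close>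

lemma cis_neg_pi_div: "1 / cis (- (pi / real n)) ^ 2 = exp (2 * of_real pi * \<i> / of_nat n)"
proof -
  have "1 / cis (- (pi / real n)) ^ 2 = inverse (cis (- (2 * pi / real n)))"
    unfolding Complex.DeMoivre by (simp add: divide_inverse mult.assoc)
  then show ?thesis
    by (simp add: cis_conv_exp mult_ac flip: exp_minus)
qed

lemma open_imp_fsigma:
  fixes S :: "'a::euclidean_space set"
  assumes "open S"
  shows "fsigma S"
proof -
  obtain C :: "nat \<Rightarrow> 'a set" where "\<And>n. compact (C n)" "\<Union>(range C) = S"
    using open_Union_compact_subsets[OF assms] by metis
  then show ?thesis
    using fsigma.intros[of C] compact_imp_closed by metis
qed

text \<open>The function (w - z0) h(w) is a local coordinate in which f - f(z0) is exactly an n-th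
  power. Here n is the order of the first nonvanishing derivative, which exists because f is not
  constant.\<close>

lemma holomorphic_power_factor:
  assumes "f holomorphic_on S" "open S" "connected S" "\<not> f constant_on S" "z0 \<in> S"
  obtains n h \<epsilon> where "0 < n" "0 < \<epsilon>" "ball z0 \<epsilon> \<subseteq> S" "h holomorphic_on ball z0 \<epsilon>"
    "\<And>w. w \<in> ball z0 \<epsilon> \<Longrightarrow> f w - f z0 = ((w - z0) * h w) ^ n"
    "\<And>w. w \<in> ball z0 \<epsilon> \<Longrightarrow> h w \<noteq> 0"
proof -
  have "\<exists>n. n > 0 \<and> (deriv ^^ n) f z0 \<noteq> 0"
  proof (rule ccontr)
    assume "\<nexists>n. n > 0 \<and> (deriv ^^ n) f z0 \<noteq> 0"
    then have "f w = f z0" if "w \<in> S" for w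
      using holomorphic_fun_eq_const_on_connected[OF assms(1-3) _ assms(5) that] by blast
    then show False using assms(4) unfolding constant_on_def by blast
  qed
  then obtain n where n: "n > 0 \<and> (deriv ^^ n) f z0 \<noteq> 0"
    and least: "\<forall>i<n. \<not> (i > 0 \<and> (deriv ^^ i) f z0 \<noteq> 0)"
    using exists_least_iff[of "\<lambda>n. n > 0 \<and> (deriv ^^ n) f z0 \<noteq> 0"] by blast
  have "0 < n" "(deriv ^^ n) f z0 \<noteq> 0" using n by blast+
  moreover have "(deriv ^^ i) f z0 = 0" if "0 < i" "i < n" for i
    using least that by blast
  ultimately have fac: "\<exists>h r. 0 < r \<and> h holomorphic_on ball z0 r \<and>
      (\<forall>w\<in>ball z0 r. f w - f z0 = ((w - z0) * h w) ^ n \<and> h w \<noteq> 0)"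
    by (rule holomorphic_factor_order_of_zero_strong[OF assms(1,2,5)]) blast+
  then obtain h r where hr: "0 < r" "h holomorphic_on ball z0 r"
    "\<forall>w\<in>ball z0 r. f w - f z0 = ((w - z0) * h w) ^ n \<and> h w \<noteq> 0"
    by blast
  obtain e where "e > 0" "ball z0 e \<subseteq> S"
    using assms(2,5) open_contains_ball by blast
  moreover have "ball z0 (min e r) \<subseteq> ball z0 e" "ball z0 (min e r) \<subseteq> ball z0 r"
    by auto
  ultimately show thesis
    using that[of n "min e r" h] \<open>0 < n\<close> hr holomorphic_on_subset[OF hr(2)] by auto
qed

text \<open>A pigeonhole argument: every point of a small ball is sent to its rotated image by some
  member of \<open>H\<close>, so countably many coincidence sets cover an uncountable ball. One of
  them is uncountable, and its member agrees with the rotation throughout the ball.\<close>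

lemma countable_preserving_rotation:
  fixes f :: "complex \<Rightarrow> complex" and H :: "(complex \<Rightarrow> complex) set"
  assumes "0 < n" "0 < \<epsilon>" "h holomorphic_on ball z0 \<epsilon>"
    and form: "\<And>w. w \<in> ball z0 \<epsilon> \<Longrightarrow> f w - f z0 = ((w - z0) * h w) ^ n"
    and nz: "\<And>w. w \<in> ball z0 \<epsilon> \<Longrightarrow> h w \<noteq> 0"
    and "countable H" and holo: "\<And>g. g \<in> H \<Longrightarrow> g holomorphic_on ball z0 \<epsilon>"
    and trans: "\<And>z w. z \<in> ball z0 \<epsilon> \<Longrightarrow> w \<in> ball z0 \<epsilon> \<Longrightarrow> f z = f w \<Longrightarrow> \<exists>g\<in>H. g z = w"
  obtains g where "g \<in> H" "g z0 = z0"
    "(g has_field_derivative exp (2 * of_real pi * \<i> / of_nat n)) (at z0)"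
proof -
  define \<zeta> where "\<zeta> = exp (2 * of_real pi * \<i> / of_nat n)"
  have \<zeta>n: "\<zeta> ^ n = 1"
    unfolding \<zeta>_def using root_of_unity_power_eq_1[OF assms(1), of n] by simp
  define \<phi> where "\<phi> w = (w - z0) * h w" for w
  have \<phi>_hol: "\<phi> holomorphic_on ball z0 \<epsilon>"
    unfolding \<phi>_def by (intro holomorphic_intros assms)
  have h_at: "(h has_field_derivative deriv h z0) (at z0)"
    using assms(2,3) holomorphic_derivI by (metis centre_in_ball open_ball)
  have \<phi>_der: "(\<phi> has_field_derivative h z0) (at z0)"
    unfolding \<phi>_def by (rule derivative_eq_intros h_at refl)+ simp
  have [simp]: "\<phi> z0 = 0" by (simp add: \<phi>_def)
  obtain r where r: "r > 0" "ball z0 r \<subseteq> ball z0 \<epsilon>" "open (\<phi> ` ball z0 r)" "inj_on \<phi> (ball z0 r)"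
    using has_complex_derivative_locally_invertible[OF \<phi>_hol, of z0] assms(2) nz[of z0] DERIV_imp_deriv[OF \<phi>_der]
    by auto
  define U where "U = ball z0 r"
  have U: "open U" "z0 \<in> U" "U \<subseteq> ball z0 \<epsilon>" "inj_on \<phi> U" "open (\<phi> ` U)"
    using r by (auto simp: U_def)
  have \<phi>_holU: "\<phi> holomorphic_on U"
    using \<phi>_hol U(3) holomorphic_on_subset by blast
  obtain \<psi> where \<psi>: "\<psi> holomorphic_on \<phi> ` U" "\<And>z. z \<in> U \<Longrightarrow> deriv \<phi> z * deriv \<psi> (\<phi> z) = 1"
    "\<And>z. z \<in> U \<Longrightarrow> \<psi> (\<phi> z) = z"
    using holomorphic_has_inverse[OF \<phi>_holU U(1,4)] by metis
  \<comment> \<open>The rotated coordinate has to stay in the domain of the local inverse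
    \<open>\<psi>\<close>; \<open>V\<close> is where it does.\<close>
  define V where "V = U \<inter> (\<lambda>z. \<zeta> * \<phi> z) -` (\<phi> ` U)"
  have "open V"
    unfolding V_def
    by (intro continuous_open_preimage continuous_intros holomorphic_on_imp_continuous_on \<phi>_holU U)
  moreover have "z0 \<in> V"
    using U(2) by (auto simp: V_def intro: image_eqI[where x = z0])
  ultimately obtain \<delta> where \<delta>: "\<delta> > 0" "ball z0 \<delta> \<subseteq> V"
    using open_contains_ball by blast
  define \<rho> where "\<rho> z = \<psi> (\<zeta> * \<phi> z)" for z
  have \<rho>U: "\<rho> z \<in> U" "\<phi> (\<rho> z) = \<zeta> * \<phi> z" if "z \<in> ball z0 \<delta>" for z
  proof -
    from that \<delta> obtain u where "u \<in> U" "\<zeta> * \<phi> z = \<phi> u" by (auto simp: V_def)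
    then show "\<rho> z \<in> U" "\<phi> (\<rho> z) = \<zeta> * \<phi> z" using \<psi>(3) by (auto simp: \<rho>_def)
  qed
  have \<delta>\<epsilon>: "ball z0 \<delta> \<subseteq> ball z0 \<epsilon>" using \<delta> U V_def by blast
  have "\<phi> holomorphic_on ball z0 \<delta>"
    using \<phi>_hol \<delta>\<epsilon> holomorphic_on_subset by blast
  then have \<rho>_hol: "\<rho> holomorphic_on ball z0 \<delta>"
    unfolding \<rho>_def
    by (intro holomorphic_on_compose_gen[OF _ \<psi>(1), unfolded o_def] holomorphic_intros)
       (use \<delta> in \<open>auto simp: V_def\<close>)
  have cover: "\<exists>g\<in>H. g z = \<rho> z" if z: "z \<in> ball z0 \<delta>" for z
  proof (rule trans)
    show z\<epsilon>: "z \<in> ball z0 \<epsilon>" using z \<delta>\<epsilon> by blast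
    show \<rho>\<epsilon>: "\<rho> z \<in> ball z0 \<epsilon>" using \<rho>U[OF z] U by blast
    have "f (\<rho> z) - f z0 = (\<zeta> * \<phi> z) ^ n"
      using form[OF \<rho>\<epsilon>] \<rho>U(2)[OF z] by (simp add: \<phi>_def)
    also have "\<dots> = f z - f z0"
      using form[OF z\<epsilon>] \<zeta>n by (simp add: \<phi>_def power_mult_distrib)
    finally show "f z = f (\<rho> z)" by simp
  qed
  have "\<exists>g\<in>H. uncountable {z \<in> ball z0 \<delta>. g z = \<rho> z}"
  proof (rule ccontr)
    assume "\<not> (\<exists>g\<in>H. uncountable {z \<in> ball z0 \<delta>. g z = \<rho> z})"
    then have "countable (\<Union>g\<in>H. {z \<in> ball z0 \<delta>. g z = \<rho> z})"
      using \<open>countable H\<close> by blast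
    moreover have "ball z0 \<delta> \<subseteq> (\<Union>g\<in>H. {z \<in> ball z0 \<delta>. g z = \<rho> z})"
      using cover by blast
    ultimately show False
      using uncountable_ball[OF \<delta>(1), of z0] countable_subset by blast
  qed
  then obtain g where g: "g \<in> H" "uncountable {z \<in> ball z0 \<delta>. g z = \<rho> z}" by blast
  have "g holomorphic_on ball z0 \<delta>"
    using holo[OF g(1)] \<delta>\<epsilon> holomorphic_on_subset by blast
  then have eq: "ball z0 \<delta> \<subseteq> {z \<in> ball z0 \<delta>. g z = \<rho> z}"
    by (rule holomorphic_countable_equal[OF _ \<rho>_hol open_ball connected_ball open_imp_fsigma[OF open_ball] g(2)])
  have \<psi>0: "\<psi> 0 = z0"
    using \<psi>(3)[OF U(2)] by simp
  have gz0: "g z0 = z0"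
    using subsetD[OF eq, of z0] \<delta>(1) \<psi>0 by (simp add: \<rho>_def)
  have "0 \<in> \<phi> ` U" using U(2) by (auto intro: image_eqI[where x = z0])
  then have \<psi>_der: "(\<psi> has_field_derivative deriv \<psi> 0) (at (\<zeta> * \<phi> z0))"
    using holomorphic_derivI[OF \<psi>(1) U(5)] by simp
  have "(\<rho> has_field_derivative deriv \<psi> 0 * (\<zeta> * h z0)) (at z0)"
    unfolding \<rho>_def
    by (rule DERIV_chain2[OF \<psi>_der DERIV_cmult[OF \<phi>_der]])
  \<comment> \<open>The derivative of \<open>\<psi>\<close> at 0 is the inverse of
    \<open>h z0\<close>, so conjugation by the coordinate does not change the multiplier.\<close>
  moreover have "deriv \<psi> 0 * (\<zeta> * h z0) = \<zeta>"
    using \<psi>(2)[OF U(2)] DERIV_imp_deriv[OF \<phi>_der] by (simp add: mult_ac)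
  ultimately have "(\<rho> has_field_derivative \<zeta>) (at z0)" by simp
  moreover have "eventually (\<lambda>z. \<rho> z = g z) (nhds z0)"
    using eventually_nhds_in_open[of "ball z0 \<delta>" z0] \<delta>(1) eq
    by (auto elim!: eventually_mono)
  ultimately have "(g has_field_derivative \<zeta>) (at z0)"
    using DERIV_cong_ev by blast
  with g(1) gz0 show thesis
    using that by (simp add: \<zeta>_def)
qed

text \<open>In the coordinate \<open>\<phi>\<close>, invariance says that the n-th powers of
  \<open>\<phi> (g w)\<close> and \<open>\<phi> w\<close> agree. Dividing both by w - z0 before
  taking the limit turns their quotient into the multiplier m.\<close>

lemma invariant_multiplier:
  fixes f g :: "complex \<Rightarrow> complex"
  assumes "0 < n" "0 < \<epsilon>" "h holomorphic_on ball z0 \<epsilon>"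
    and form: "\<And>w. w \<in> ball z0 \<epsilon> \<Longrightarrow> f w - f z0 = ((w - z0) * h w) ^ n"
    and nz: "\<And>w. w \<in> ball z0 \<epsilon> \<Longrightarrow> h w \<noteq> 0"
    and g: "(g has_field_derivative m) (at z0)" "g z0 = z0"
    and inv: "\<And>w. w \<in> ball z0 \<epsilon> \<Longrightarrow> f (g w) = f w"
  shows "m ^ n = 1"
proof -
  define \<phi> where "\<phi> w = (w - z0) * h w" for w
  have h_at: "(h has_field_derivative deriv h z0) (at z0)"
    using assms(2,3) holomorphic_derivI by (metis centre_in_ball open_ball)
  have \<phi>_der: "(\<phi> has_field_derivative h z0) (at z0)"
    unfolding \<phi>_def by (rule derivative_eq_intros h_at refl)+ simp
  have [simp]: "\<phi> z0 = 0" by (simp add: \<phi>_def)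
  have "((\<lambda>w. \<phi> (g w)) has_field_derivative h z0 * m) (at z0)"
    by (rule DERIV_chain2) (use \<phi>_der g in auto)
  then have "((\<lambda>w. \<phi> (g w) / (w - z0)) \<longlongrightarrow> h z0 * m) (at z0)"
    unfolding has_field_derivative_iff using g by simp
  moreover have "((\<lambda>w. \<phi> w / (w - z0)) \<longlongrightarrow> h z0) (at z0)"
    using \<phi>_der unfolding has_field_derivative_iff by simp
  moreover have "h z0 \<noteq> 0" using nz assms(2) by simp
  ultimately have "((\<lambda>w. ((\<phi> (g w) / (w - z0)) / (\<phi> w / (w - z0))) ^ n) \<longlongrightarrow> (h z0 * m / h z0) ^ n) (at z0)"
    by (intro tendsto_intros)
  moreover have "eventually (\<lambda>w. ((\<phi> (g w) / (w - z0)) / (\<phi> w / (w - z0))) ^ n = 1) (at z0)"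
  proof -
    have "isCont g z0" using g(1) DERIV_isCont by blast
    then have "g \<midarrow>z0\<rightarrow> z0" using g(2) by (simp add: isCont_def)
    then have "eventually (\<lambda>w. g w \<in> ball z0 \<epsilon>) (at z0)"
      using assms(2) by (intro topological_tendstoD) auto
    moreover have "eventually (\<lambda>w. w \<in> ball z0 \<epsilon> - {z0}) (at z0)"
      using assms(2) by (intro eventually_at_in_open) auto
    ultimately show ?thesis
    proof eventually_elim
      case (elim w)
      then have "\<phi> w ^ n = \<phi> (g w) ^ n"
        using form[of w] form[of "g w"] inv[of w] by (simp add: \<phi>_def)
      moreover have "\<phi> w \<noteq> 0" using elim nz by (simp add: \<phi>_def)
      ultimately have "\<phi> (g w) ^ n / \<phi> w ^ n = 1"
        by (metis divide_self power_not_zero)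
      then show ?case using elim by (simp add: power_divide)
    qed
  qed
  ultimately have "((\<lambda>w. 1) \<longlongrightarrow> (h z0 * m / h z0) ^ n) (at z0)"
    by (rule Lim_transform_eventually)
  then have "(h z0 * m / h z0) ^ n = 1"
    using LIM_const_eq by metis
  then show ?thesis
    using \<open>h z0 \<noteq> 0\<close> by simp
qed

section \<open>Ramification indices of the invariant function\<close>

locale triangle_function = triangle_invariant +
  assumes holo: "\<theta> holomorphic_on UHP"
    and sep: "\<And>z w. Im z > 0 \<Longrightarrow> Im w > 0 \<Longrightarrow> \<theta> z = \<theta> w \<Longrightarrow> \<exists>g\<in>\<Gamma>. moeb g z = w"
begin

lemma theta_nonconstant: "\<not> \<theta> constant_on UHP"
proof
  assume "\<theta> constant_on UHP"
  then have "\<theta> (fixA p) = \<theta> (fixB q)"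
    unfolding constant_on_def using Im_fix p2 q2 by (metis UHP_iff)
  then show False using theta_fixA theta_fixB by simp
qed

text \<open>Points with equal \<open>\<theta>\<close> lie in one orbit, so the stabilizer of the
  model fixed point can be transported to any point of its fibre without changing the automorphy
  factor.\<close>

lemma conjugate_multiplier:
  assumes "s \<in> \<Gamma>" "Im w > 0" "moeb s w = w" "Im z > 0" "\<theta> z = \<theta> w"
  obtains g where "g \<in> \<Gamma>" "moeb g z = z" "autf g z = autf s w"
proof -
  obtain k where k: "k \<in> \<Gamma>" "moeb k z = w"
    using sep assms by blast
  have dk: "mdet k = 1" and ds: "mdet s = 1" and kw: "moeb (minv k) w = z"
    using mdet_Gamma[OF k(1)] mdet_Gamma[OF assms(1)] moeb_minv_moeb[OF mdet_Gamma[OF k(1)] assms(4)] k(2)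
    by simp_all
  define g where "g = mmul (minv k) (mmul s k)"
  have "g \<in> \<Gamma>" using k assms by (simp add: g_def Gamma_mmul Gamma_minv)
  moreover have "moeb g z = z"
    using k assms dk ds kw by (simp add: g_def moeb_mmul mdet_mmul)
  moreover have "autf g z = autf (minv k) w * autf k z * autf s w"
    using k assms dk ds kw by (simp add: g_def moeb_mmul autf_mmul mdet_mmul)
  moreover have "autf (minv k) w * autf k z = 1"
    using autf_mmul[OF dk assms(4), of "minv k"] dk k by (simp add: mmul_minv) (simp add: mat_id_def)
  ultimately show thesis using that by simp
qed

lemma ramification:
  assumes z0: "Im z0 > 0" and n: "0 < n" "0 < \<epsilon>" "ball z0 \<epsilon> \<subseteq> UHP" "h holomorphic_on ball z0 \<epsilon>"
    and form: "\<And>w. w \<in> ball z0 \<epsilon> \<Longrightarrow> \<theta> w - \<theta> z0 = ((w - z0) * h w) ^ n"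
    and nz: "\<And>w. w \<in> ball z0 \<epsilon> \<Longrightarrow> h w \<noteq> 0"
  shows "n = (if \<theta> z0 = 0 then p else if \<theta> z0 = 1 then q else 1)"
proof -
  \<comment> \<open>The local rotation comes from \<open>\<Gamma>\<close> and has a multiplier of
    exact order n; tameness bounds the order of that multiplier.\<close>
  have upper: "n = 1 \<or> \<theta> z0 = 0 \<and> n dvd p \<or> \<theta> z0 = 1 \<and> n dvd q"
  proof -
    obtain g' where g': "g' \<in> moeb ` \<Gamma>" "g' z0 = z0"
      "(g' has_field_derivative exp (2 * of_real pi * \<i> / of_nat n)) (at z0)"
    proof (rule countable_preserving_rotation[OF n(1,2,4) form nz])
      show "countable (moeb ` \<Gamma>)" using countable_Gamma by simp
      show "g holomorphic_on ball z0 \<epsilon>" if "g \<in> moeb ` \<Gamma>" for g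
        using that moeb_holomorphic mdet_Gamma n(3) holomorphic_on_subset by blast
      show "\<exists>g\<in>moeb ` \<Gamma>. g z = w" if "z \<in> ball z0 \<epsilon>" "w \<in> ball z0 \<epsilon>" "\<theta> z = \<theta> w" for z w
      proof -
        have "z \<in> UHP" "w \<in> UHP" using that n(3) by auto
        then show ?thesis using sep that(3) by force
      qed
    qed blast
    then obtain g where g: "g \<in> \<Gamma>" "g' = moeb g" by blast
    have "1 / autf g z0 ^ 2 = exp (2 * of_real pi * \<i> / of_nat n)"
      using DERIV_unique[OF moeb_has_field_derivative[OF mdet_Gamma[OF g(1)] z0]] g'(3) g(2) by blast
    then have m: "(1 / autf g z0 ^ 2) ^ k = 1 \<longleftrightarrow> n dvd k" for k
      using root_of_unity_power_eq_1[OF n(1)] by simp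
    have t: "autf g z0 ^ 2 = 1 \<or> \<theta> z0 = 0 \<and> autf g z0 ^ (2 * p) = 1 \<or> \<theta> z0 = 1 \<and> autf g z0 ^ (2 * q) = 1"
      using tame_Gamma[OF g(1)] z0 g'(2) unfolding g(2) tame_def by blast
    have "n dvd k" if "autf g z0 ^ (2 * k) = 1" for k
    proof -
      have "(1 / autf g z0 ^ 2) ^ k = 1"
        using that by (simp only: power_divide power_mult power_one div_by_1)
      then show ?thesis using m by blast
    qed
    from this[of 1] this[of p] this[of q] t show ?thesis by auto
  qed
  \<comment> \<open>A conjugate of a generator fixes z0 with a multiplier of exact order k, and
    invariance of \<open>\<theta>\<close> makes the n-th power of this multiplier equal to
    1.\<close>
  have lower: "k dvd n" if lw: "2 \<le> k" "s \<in> \<Gamma>" "Im w > 0" "moeb s w = w" "\<theta> z0 = \<theta> w"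
     "autf s w = cis (- (pi / real k))" for k s w
  proof -
    obtain g where g: "g \<in> \<Gamma>" "moeb g z0 = z0" "autf g z0 = autf s w"
      using conjugate_multiplier[OF lw(2-4) z0 lw(5)] by blast
    have "(1 / autf g z0 ^ 2) ^ n = 1"
    proof (rule invariant_multiplier[where g = "moeb g", OF n(1,2,4) form nz _ g(2)])
      show "(moeb g has_field_derivative 1 / (autf g z0)\<^sup>2) (at z0)"
        using moeb_has_field_derivative mdet_Gamma g z0 by blast
      show "\<theta> (moeb g w) = \<theta> w" if "w \<in> ball z0 \<epsilon>" for w
        using inv[OF g(1)] that n(3) by auto
    qed
    then show ?thesis
      using root_of_unity_power_eq_1[of k n] lw(1) cis_neg_pi_div[of k] by (simp add: g(3) lw(6))
  qed
  have "\<theta> z0 = 0 \<Longrightarrow> p dvd n"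
    using lower[OF p2 A0_Gamma Im_fix(1)[OF p2] moeb_fixA _ autf_fixA] theta_fixA by simp
  moreover have "\<theta> z0 = 1 \<Longrightarrow> q dvd n"
    using lower[OF q2 B0_Gamma Im_fix(2)[OF q2] moeb_fixB _ autf_fixB] theta_fixB by simp
  ultimately show ?thesis
    using upper p2 q2 by (auto intro: dvd_antisym)
qed

end

section \<open>Branches of fractional powers\<close>

lemma deriv_eqI_eventually:
  assumes "(f has_field_derivative D) (at z)" "eventually (\<lambda>w. f w = g w) (nhds z)"
  shows "deriv g z = D"
  by (rule DERIV_imp_deriv[OF iffD1[OF DERIV_cong_ev[OF refl assms(2) refl] assms(1)]])

text \<open>Balls are uncountable, so removing a countable set leaves a dense subset of
  \<open>S\<close>.\<close>

lemma continuous_eq_off_countable: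
  fixes f g :: "'a::euclidean_space \<Rightarrow> 'b::t2_space"
  assumes "open S" "continuous_on S f" "continuous_on S g" "countable E"
    and "\<And>z. z \<in> S - E \<Longrightarrow> f z = g z" "z \<in> S"
  shows "f z = g z"
proof (rule tendsto_unique)
  have "z islimpt (S - E)"
    unfolding islimpt_def
  proof (intro allI impI)
    fix T assume "z \<in> T" "open T"
    then obtain e where e: "e > 0" "ball z e \<subseteq> T \<inter> S"
      using assms(1,6) by (meson IntI open_Int open_contains_ball)
    have "uncountable (ball z e - (E \<union> {z}))"
      by (intro uncountable_minus_countable uncountable_ball e) (use assms(4) in simp)
    then have "ball z e - (E \<union> {z}) \<noteq> {}"
      by (metis countable_empty)
    then obtain y where y: "y \<in> ball z e" "y \<notin> E" "y \<noteq> z" by blast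
    then have "y \<in> T" "y \<in> S" using e(2) by blast+
    then show "\<exists>y\<in>S - E. y \<in> T \<and> y \<noteq> z"
      using y by blast
  qed
  then show "at z within (S - E) \<noteq> bot"
    by (simp add: trivial_limit_within)
  show "(f \<longlongrightarrow> f z) (at z within (S - E))"
    using assms(2,6) by (auto simp: continuous_on_def intro: tendsto_within_subset)
  have "(g \<longlongrightarrow> g z) (at z within (S - E))"
    using assms(3,6) by (auto simp: continuous_on_def intro: tendsto_within_subset)
  then show "(f \<longlongrightarrow> g z) (at z within (S - E))"
    by (rule Lim_transform_eventually) (use assms(5) in \<open>auto simp: eventually_at_filter\<close>)
qed

text \<open>Off \<open>E\<close> the quotient is a continuous map from a connected set into the
  finite set of r-th roots of unity, hence constant. Density extends the relation over the possible
  zeros of g. This compares two branches of one r-th root.\<close>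

lemma continuous_roots_proportional:
  fixes f g :: "complex \<Rightarrow> complex"
  assumes "open S" "connected S" "continuous_on S f" "continuous_on S g" "countable E" "0 < r"
    and "\<And>z. z \<in> S - E \<Longrightarrow> g z \<noteq> 0" "\<And>z. z \<in> S - E \<Longrightarrow> f z ^ r = g z ^ r"
  obtains c where "c ^ r = 1" "\<And>z. z \<in> S \<Longrightarrow> f z = c * g z"
proof -
  have "connected (S - E)"
    using connected_open_diff_countable[OF _ assms(1,2,5)] by simp
  moreover have "continuous_on (S - E) (\<lambda>z. f z / g z)"
    using assms by (intro continuous_on_divide) (auto intro: continuous_on_subset)
  moreover have roots: "(\<lambda>z. f z / g z) ` (S - E) \<subseteq> {x. x ^ r = 1}"
    using assms(7,8) by (auto simp: power_divide)
  moreover have "finite {x::complex. x ^ r = 1}"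
    using assms(6) card_complex_roots_unity[of r] by (intro card_ge_0_finite) simp
  ultimately have "(\<lambda>z. f z / g z) constant_on (S - E)"
    by (meson continuous_finite_range_constant finite_subset)
  then obtain c where c: "\<And>z. z \<in> S - E \<Longrightarrow> f z / g z = c"
    unfolding constant_on_def by blast
  \<comment> \<open>If \<open>S - E\<close> is empty, \<open>c\<close> is arbitrary; the default 1
    keeps the constant a root of unity.\<close>
  define c' where "c' = (if S - E = {} then 1 else c)"
  have "c' ^ r = 1"
    using c roots by (fastforce simp: c'_def)
  moreover have "f z = c' * g z" if "z \<in> S" for z
  proof (rule continuous_eq_off_countable[OF assms(1,3) _ assms(5) _ that])
    show "continuous_on S (\<lambda>z. c' * g z)" by (intro continuous_intros assms)
    show "f w = c' * g w" if "w \<in> S - E" for w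
      using c[OF that] assms(7)[OF that] that by (auto simp: c'_def field_simps)
  qed
  ultimately show thesis using that by blast
qed

text \<open>An order count: u vanishes to order n, its derivative-like companion d to order n - 1,
  and v not at all, so \<open>deg\<close> says that f has order e. The limit is taken of the r-th
  power, which avoids choosing a root.\<close>

lemma branch_leading_coeff:
  fixes f d u v :: "complex \<Rightarrow> complex"
  assumes "((\<lambda>z. u z / (z - z0) ^ n) \<longlongrightarrow> c1) (at z0)" "(v \<longlongrightarrow> c2) (at z0)"
    "((\<lambda>z. d z / (z - z0) ^ (n - 1)) \<longlongrightarrow> c3) (at z0)"
    and nz: "c1 \<noteq> 0" "c2 \<noteq> 0" "c3 \<noteq> 0"
    and ev: "eventually (\<lambda>z. f z ^ r = d z ^ s / (u z ^ i * v z ^ j)) (at z0)"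
    and deg: "s * (n - 1) = i * n + r * e"
  obtains c where "c \<noteq> 0" "((\<lambda>z. (f z / (z - z0) ^ e) ^ r) \<longlongrightarrow> c) (at z0)"
proof -
  have "((\<lambda>z. (d z / (z - z0) ^ (n - 1)) ^ s / ((u z / (z - z0) ^ n) ^ i * v z ^ j))
       \<longlongrightarrow> c3 ^ s / (c1 ^ i * c2 ^ j)) (at z0)"
    using nz by (intro tendsto_intros assms) auto
  moreover have "eventually (\<lambda>z. (d z / (z - z0) ^ (n - 1)) ^ s / ((u z / (z - z0) ^ n) ^ i * v z ^ j)
      = (f z / (z - z0) ^ e) ^ r) (at z0)"
    using ev eventually_at_ball'[OF zero_less_one, of z0 UNIV]
  proof eventually_elim
    case (elim z)
    define x where "x = z - z0"
    have "x \<noteq> 0" using elim by (auto simp: x_def)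
    have "(d z / x ^ (n - 1)) ^ s / ((u z / x ^ n) ^ i * v z ^ j)
        = (d z ^ s / (u z ^ i * v z ^ j)) * (x ^ (i * n) / x ^ (s * (n - 1)))"
      by (simp add: power_divide mult.commute flip: power_mult)
    also have "x ^ (i * n) / x ^ (s * (n - 1)) = 1 / x ^ (r * e)"
      using \<open>x \<noteq> 0\<close> unfolding deg by (simp add: power_add)
    also have "(d z ^ s / (u z ^ i * v z ^ j)) * (1 / x ^ (r * e)) = (f z / x ^ e) ^ r"
      using elim by (simp add: power_divide mult.commute flip: power_mult)
    finally show ?case by (simp add: x_def)
  qed
  ultimately have "((\<lambda>z. (f z / (z - z0) ^ e) ^ r) \<longlongrightarrow> c3 ^ s / (c1 ^ i * c2 ^ j)) (at z0)"
    by (rule Lim_transform_eventually)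
  then show thesis
    using that[of "c3 ^ s / (c1 ^ i * c2 ^ j)"] nz by simp
qed

lemma nonzero_of_leading_coeff:
  fixes f :: "complex \<Rightarrow> complex"
  assumes "isCont f z0" "0 < r" "c \<noteq> 0" "((\<lambda>z. (f z / (z - z0) ^ 0) ^ r) \<longlongrightarrow> c) (at z0)"
  shows "f z0 \<noteq> 0"
proof -
  have "((\<lambda>z. f z ^ r) \<longlongrightarrow> f z0 ^ r) (at z0)"
    using assms(1) by (intro tendsto_intros) (simp add: isCont_def)
  then have "f z0 ^ r = c"
    using assms(4) LIM_unique by fastforce
  then show ?thesis using assms by auto
qed

lemma simple_zero_of_leading_coeff:
  fixes f :: "complex \<Rightarrow> complex"
  assumes f: "(f has_field_derivative D) (at z0)" and "0 < r" "c \<noteq> 0"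
    "((\<lambda>z. (f z / (z - z0) ^ 1) ^ r) \<longlongrightarrow> c) (at z0)"
  shows "f z0 = 0" "D \<noteq> 0"
proof -
  have "((\<lambda>z. (f z / (z - z0) ^ 1) ^ r * (z - z0) ^ r) \<longlongrightarrow> c * (z0 - z0) ^ r) (at z0)"
    by (intro tendsto_intros assms)
  moreover have "eventually (\<lambda>z. (f z / (z - z0) ^ 1) ^ r * (z - z0) ^ r = f z ^ r) (at z0)"
    using eventually_at_ball'[OF zero_less_one, of z0 UNIV]
    by eventually_elim (simp add: power_divide)
  ultimately have "((\<lambda>z. f z ^ r) \<longlongrightarrow> c * (z0 - z0) ^ r) (at z0)"
    by (rule Lim_transform_eventually)
  then have lim0: "((\<lambda>z. f z ^ r) \<longlongrightarrow> 0) (at z0)"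
    using assms(2) by (simp add: power_0_left)
  have "((\<lambda>z. f z ^ r) \<longlongrightarrow> f z0 ^ r) (at z0)"
    using DERIV_isCont[OF f] by (intro tendsto_intros) (simp add: isCont_def)
  from LIM_unique[OF this lim0] show "f z0 = 0" using assms(2) by simp
  then have "((\<lambda>z. (f z / (z - z0)) ^ r) \<longlongrightarrow> D ^ r) (at z0)"
    using f unfolding has_field_derivative_iff by (intro tendsto_intros) simp
  then have "D ^ r = c"
    using assms(4) LIM_unique by fastforce
  then show "D \<noteq> 0" using assms by auto
qed

section \<open>Local behaviour of theta and of the branches\<close>

context triangle_function
begin

definition ram :: "complex \<Rightarrow> nat" where
  "ram z = (if \<theta> z = 0 then p else if \<theta> z = 1 then q else 1)"

text \<open>Both limits are read off from the local n-th power form of \<open>\<theta>\<close>, once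
  \<open>ramification\<close> has identified n with \<open>ram z0\<close>.\<close>

lemma theta_leading_coeff:
  assumes "Im z0 > 0"
  obtains c d where "c \<noteq> 0" "d \<noteq> 0" "((\<lambda>z. (\<theta> z - \<theta> z0) / (z - z0) ^ ram z0) \<longlongrightarrow> c) (at z0)"
    "((\<lambda>z. deriv \<theta> z / (z - z0) ^ (ram z0 - 1)) \<longlongrightarrow> d) (at z0)"
proof -
  obtain n h \<epsilon> where n: "0 < n" "0 < \<epsilon>" "ball z0 \<epsilon> \<subseteq> UHP" "h holomorphic_on ball z0 \<epsilon>"
    and form: "\<And>w. w \<in> ball z0 \<epsilon> \<Longrightarrow> \<theta> w - \<theta> z0 = ((w - z0) * h w) ^ n"
    and nz: "\<And>w. w \<in> ball z0 \<epsilon> \<Longrightarrow> h w \<noteq> 0"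
    using holomorphic_power_factor[OF holo open_UHP connected_UHP theta_nonconstant, of z0] assms
    by (metis UHP_iff)
  have ram: "ram z0 = n"
    using ramification[OF assms n form nz] by (simp add: ram_def)
  have hd: "(h has_field_derivative deriv h z) (at z)" if "z \<in> ball z0 \<epsilon>" for z
    using holomorphic_derivI[OF n(4) open_ball that] .
  have der: "deriv \<theta> z = of_nat n * (h z + (z - z0) * deriv h z) * ((z - z0) * h z) ^ (n - 1)"
    if z: "z \<in> ball z0 \<epsilon>" for z
  proof -
    have "((\<lambda>w. ((w - z0) * h w) ^ n + \<theta> z0) has_field_derivative
        of_nat n * (h z + (z - z0) * deriv h z) * ((z - z0) * h z) ^ (n - 1)) (at z)"
      by (rule derivative_eq_intros hd[OF z] refl)+ (simp add: algebra_simps)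
    moreover have "eventually (\<lambda>w. ((w - z0) * h w) ^ n + \<theta> z0 = \<theta> w) (nhds z)"
      using eventually_nhds_in_open[OF open_ball z]
      by eventually_elim (simp add: flip: form)
    ultimately show ?thesis
      by (rule deriv_eqI_eventually)
  qed
  have cont: "continuous_on (ball z0 \<epsilon>) h" "continuous_on (ball z0 \<epsilon>) (deriv h)"
    using n(4) holomorphic_on_imp_continuous_on holomorphic_deriv by blast+
  have lim: "(h \<longlongrightarrow> h z0) (at z0)" "(deriv h \<longlongrightarrow> deriv h z0) (at z0)"
    using cont n(2) unfolding continuous_on_eq_continuous_at[OF open_ball] isCont_def
    by (metis centre_in_ball)+
  have ev: "eventually (\<lambda>z. z \<in> ball z0 \<epsilon> - {z0}) (at z0)"
    using n(2) by (intro eventually_at_in_open) auto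
  have "((\<lambda>z. h z ^ n) \<longlongrightarrow> h z0 ^ n) (at z0)"
    by (intro tendsto_intros lim)
  moreover have "eventually (\<lambda>z. h z ^ n = (\<theta> z - \<theta> z0) / (z - z0) ^ n) (at z0)"
    using ev by eventually_elim (simp add: form power_mult_distrib)
  ultimately have 1: "((\<lambda>z. (\<theta> z - \<theta> z0) / (z - z0) ^ n) \<longlongrightarrow> h z0 ^ n) (at z0)"
    by (rule Lim_transform_eventually)
  have "((\<lambda>z. of_nat n * (h z + (z - z0) * deriv h z) * h z ^ (n - 1)) \<longlongrightarrow>
      of_nat n * (h z0 + (z0 - z0) * deriv h z0) * h z0 ^ (n - 1)) (at z0)"
    by (intro tendsto_intros lim)
  moreover have "eventually (\<lambda>z. of_nat n * (h z + (z - z0) * deriv h z) * h z ^ (n - 1)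
      = deriv \<theta> z / (z - z0) ^ (n - 1)) (at z0)"
    using ev by eventually_elim (simp add: der power_mult_distrib)
  ultimately have 2: "((\<lambda>z. deriv \<theta> z / (z - z0) ^ (n - 1)) \<longlongrightarrow>
      of_nat n * (h z0 + (z0 - z0) * deriv h z0) * h z0 ^ (n - 1)) (at z0)"
    by (rule Lim_transform_eventually)
  show thesis
    using that[of "h z0 ^ n" "of_nat n * (h z0 + (z0 - z0) * deriv h z0) * h z0 ^ (n - 1)"]
      1 2 n(1,2) nz[of z0] by (simp add: ram)
qed

lemma theta_has_derivative:
  assumes "Im z > 0"
  shows "(\<theta> has_field_derivative deriv \<theta> z) (at z)"
  by (rule holomorphic_derivI[OF holo open_UHP]) (use assms in simp)

lemma deriv_theta_isCont: "Im z > 0 \<Longrightarrow> isCont (deriv \<theta>) z"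
  using holomorphic_on_imp_continuous_on[OF holomorphic_deriv[OF holo open_UHP]]
  by (simp add: continuous_on_eq_continuous_at[OF open_UHP])

lemma theta_isCont: "Im z > 0 \<Longrightarrow> isCont \<theta> z"
  by (rule DERIV_isCont[OF theta_has_derivative])

lemma deriv_theta_nonzero:
  assumes "Im z > 0" "\<theta> z \<noteq> 0" "\<theta> z \<noteq> 1"
  shows "deriv \<theta> z \<noteq> 0"
proof -
  obtain d where "d \<noteq> 0" "(deriv \<theta> \<longlongrightarrow> d) (at z)"
    using theta_leading_coeff[OF assms(1)] assms(2,3) by (auto simp: ram_def)
  then show ?thesis
    using deriv_theta_isCont[OF assms(1)] LIM_unique unfolding isCont_def by blast
qed

text \<open>One predicate covers all three forms; the degree of the form is s / r. The equation is
  imposed off the fibres over 0 and 1, where the quotient would divide by zero; holomorphy governs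
  the values there.\<close>

definition is_branch :: "nat \<Rightarrow> nat \<Rightarrow> nat \<Rightarrow> nat \<Rightarrow> (complex \<Rightarrow> complex) \<Rightarrow> bool" where
  "is_branch r s i j f \<longleftrightarrow> f holomorphic_on UHP \<and>
     (\<forall>z\<in>UHP. \<theta> z \<noteq> 0 \<and> \<theta> z \<noteq> 1 \<longrightarrow> f z ^ r = deriv \<theta> z ^ s / (\<theta> z ^ i * (\<theta> z - 1) ^ j))"

text \<open>Near z0 the leading coefficient keeps \<open>\<theta>\<close> away from its value at z0,
  and continuity keeps it within distance 1, which excludes the other special value.\<close>

lemma branch_eventually:
  assumes "is_branch r s i j f" "Im z0 > 0" "\<theta> z0 = 0 \<or> \<theta> z0 = 1"
  shows "eventually (\<lambda>z. f z ^ r = deriv \<theta> z ^ s / (\<theta> z ^ i * (\<theta> z - 1) ^ j)) (at z0)"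
proof -
  obtain c where c: "c \<noteq> 0" "((\<lambda>z. (\<theta> z - \<theta> z0) / (z - z0) ^ ram z0) \<longlongrightarrow> c) (at z0)"
    using theta_leading_coeff[OF assms(2)] by metis
  have "eventually (\<lambda>z. (\<theta> z - \<theta> z0) / (z - z0) ^ ram z0 \<noteq> 0) (at z0)"
    using tendsto_imp_eventually_ne[OF c(2,1)] .
  moreover have "eventually (\<lambda>z. dist (\<theta> z) (\<theta> z0) < 1) (at z0)"
    using theta_isCont[OF assms(2)] unfolding isCont_def by (rule tendstoD) simp
  moreover have "eventually (\<lambda>z. z \<in> UHP - {z0}) (at z0)"
    using assms(2) by (intro eventually_at_in_open open_UHP) simp
  ultimately show ?thesis
  proof eventually_elim
    case (elim z)
    then have "\<theta> z \<noteq> 0 \<and> \<theta> z \<noteq> 1"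
      using assms(3) by (auto simp: dist_norm)
    then show ?case using assms(1) elim unfolding is_branch_def by simp
  qed
qed

lemma branch_leading_0:
  assumes "is_branch r s i j f" "Im z0 > 0" "\<theta> z0 = 0" "s * (p - 1) = i * p + r * e"
  obtains c where "c \<noteq> 0" "((\<lambda>z. (f z / (z - z0) ^ e) ^ r) \<longlongrightarrow> c) (at z0)"
proof -
  have ram: "ram z0 = p" using assms by (simp add: ram_def)
  obtain c d where cd: "c \<noteq> 0" "d \<noteq> 0" "((\<lambda>z. \<theta> z / (z - z0) ^ p) \<longlongrightarrow> c) (at z0)"
    "((\<lambda>z. deriv \<theta> z / (z - z0) ^ (p - 1)) \<longlongrightarrow> d) (at z0)"
    using theta_leading_coeff[OF assms(2)] unfolding ram assms(3) by auto
  have v: "((\<lambda>z. \<theta> z - 1) \<longlongrightarrow> -1) (at z0)"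
    using tendsto_diff[OF theta_isCont[OF assms(2), unfolded isCont_def] tendsto_const[of 1]] assms(3)
    by simp
  show thesis
    by (rule branch_leading_coeff[OF cd(3) v cd(4) cd(1) _ cd(2)
          branch_eventually[OF assms(1,2)] assms(4)]) (use assms(3) that in auto)
qed

lemma branch_leading_1:
  assumes "is_branch r s i j f" "Im z0 > 0" "\<theta> z0 = 1" "s * (q - 1) = j * q + r * e"
  obtains c where "c \<noteq> 0" "((\<lambda>z. (f z / (z - z0) ^ e) ^ r) \<longlongrightarrow> c) (at z0)"
proof -
  have ram: "ram z0 = q" using assms by (simp add: ram_def)
  obtain c d where cd: "c \<noteq> 0" "d \<noteq> 0" "((\<lambda>z. (\<theta> z - 1) / (z - z0) ^ q) \<longlongrightarrow> c) (at z0)"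
    "((\<lambda>z. deriv \<theta> z / (z - z0) ^ (q - 1)) \<longlongrightarrow> d) (at z0)"
    using theta_leading_coeff[OF assms(2)] unfolding ram assms(3) by auto
  have v: "(\<theta> \<longlongrightarrow> 1) (at z0)"
    using theta_isCont[OF assms(2)] assms(3) unfolding isCont_def by simp
  have ev: "eventually (\<lambda>z. f z ^ r = deriv \<theta> z ^ s / ((\<theta> z - 1) ^ j * \<theta> z ^ i)) (at z0)"
    using branch_eventually[OF assms(1,2)] assms(3) by (simp add: mult.commute)
  show thesis
    by (rule branch_leading_coeff[OF cd(3) v cd(4) cd(1) _ cd(2) ev assms(4)]) (use that in auto)
qed

lemma branch_nonzero_generic:
  assumes "is_branch r s i j f" "0 < r" "Im z > 0" "\<theta> z \<noteq> 0" "\<theta> z \<noteq> 1"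
  shows "f z \<noteq> 0"
proof
  assume "f z = 0"
  then have "deriv \<theta> z ^ s / (\<theta> z ^ i * (\<theta> z - 1) ^ j) = 0"
    using assms unfolding is_branch_def by (metis UHP_iff power_eq_0_iff)
  then show False using deriv_theta_nonzero assms by auto
qed

lemma branch_derivative:
  "is_branch r s i j f \<Longrightarrow> Im z > 0 \<Longrightarrow> (f has_field_derivative deriv f z) (at z)"
  unfolding is_branch_def by (rule holomorphic_derivI[OF _ open_UHP]) auto

lemma branch_isCont: "is_branch r s i j f \<Longrightarrow> Im z > 0 \<Longrightarrow> isCont f z"
  by (rule DERIV_isCont[OF branch_derivative])

lemma countable_fibre: "countable {z \<in> UHP. \<theta> z = c}"
proof (cases "\<exists>w\<in>UHP. \<theta> w = c")
  case True
  then obtain w where w: "w \<in> UHP" "\<theta> w = c" by blast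
  have "{z \<in> UHP. \<theta> z = c} \<subseteq> (\<lambda>g. moeb g w) ` \<Gamma>"
    using sep[of w] w by force
  then show ?thesis by (rule countable_subset) (simp add: countable_Gamma)
next
  case False
  then have "{z \<in> UHP. \<theta> z = c} = {}" by blast
  then show ?thesis by (metis countable_empty)
qed

lemma countable_special: "countable {z \<in> UHP. \<theta> z = 0 \<or> \<theta> z = 1}"
proof -
  have "{z \<in> UHP. \<theta> z = 0 \<or> \<theta> z = 1} = {z \<in> UHP. \<theta> z = 0} \<union> {z \<in> UHP. \<theta> z = 1}" by blast
  then show ?thesis using countable_fibre by simp
qed

text \<open>Differentiating the invariance of \<open>\<theta>\<close> shows that its derivative
  transforms with weight 1. Hence both sides have the same r-th power, with exp (s / r L) serving as
  the power s / r of the derivative of the lift, and they differ by a constant root of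
  unity.\<close>

lemma branch_character:
  assumes f: "is_branch r s i j f" and "0 < r" and lift: "is_lift (g, L)" and "g \<in> \<Gamma>"
  obtains c where "c ^ r = 1"
    "\<And>z. Im z > 0 \<Longrightarrow> f (moeb g z) * exp (of_nat s / of_nat r * L z) = c * f z"
proof -
  have dg: "mdet g = 1" using mdet_Gamma assms by blast
  have contf: "continuous_on UHP f"
    using f holomorphic_on_imp_continuous_on unfolding is_branch_def by blast
  have "continuous_on UHP (\<lambda>z. f (moeb g z))"
    by (rule continuous_on_compose2[OF contf])
       (use moeb_holomorphic[OF dg] holomorphic_on_imp_continuous_on Im_moeb[OF dg] in auto)
  moreover have "continuous_on UHP L" using lift by (simp add: is_lift_def)
  ultimately have cont: "continuous_on UHP (\<lambda>z. f (moeb g z) * exp (of_nat s / of_nat r * L z))"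
    by (intro continuous_intros)
  have pw: "(f (moeb g z) * exp (of_nat s / of_nat r * L z)) ^ r = f z ^ r" "f z \<noteq> 0"
    if "z \<in> UHP - {z \<in> UHP. \<theta> z = 0 \<or> \<theta> z = 1}" for z
  proof -
    have z: "Im z > 0" "\<theta> z \<noteq> 0" "\<theta> z \<noteq> 1" using that by auto
    then show "f z \<noteq> 0" using branch_nonzero_generic[OF f assms(2)] by blast
    define m where "m = deriv (moeb g) z"
    have md: "(moeb g has_field_derivative m) (at z)"
      using moeb_has_field_derivative[OF dg z(1)] DERIV_imp_deriv[OF moeb_has_field_derivative[OF dg z(1)]]
      by (simp add: m_def)
    have gz: "Im (moeb g z) > 0" using Im_moeb dg z by blast
    have "((\<lambda>z. \<theta> (moeb g z)) has_field_derivative deriv \<theta> (moeb g z) * m) (at z)"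
      by (rule DERIV_chain2[OF theta_has_derivative[OF gz] md])
    moreover have "eventually (\<lambda>w. \<theta> (moeb g w) = \<theta> w) (nhds z)"
      using eventually_nhds_in_open[OF open_UHP, of z] z(1)
      by (auto elim!: eventually_mono intro!: inv[OF \<open>g \<in> \<Gamma>\<close>])
    ultimately have dt: "deriv \<theta> z = deriv \<theta> (moeb g z) * m"
      by (rule deriv_eqI_eventually)
    have br: "f w ^ r = deriv \<theta> w ^ s / (\<theta> w ^ i * (\<theta> w - 1) ^ j)"
      if "Im w > 0" "\<theta> w \<noteq> 0" "\<theta> w \<noteq> 1" for w
      using f that unfolding is_branch_def by simp
    have "exp (of_nat s / of_nat r * L z) ^ r = exp (L z) ^ s"
      using assms(2) by (simp flip: exp_of_nat_mult)
    also have "exp (L z) = m" using lift z by (simp add: is_lift_def m_def)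
    finally have "(f (moeb g z) * exp (of_nat s / of_nat r * L z)) ^ r = f (moeb g z) ^ r * m ^ s"
      by (simp add: power_mult_distrib)
    also have "\<dots> = (deriv \<theta> (moeb g z) * m) ^ s / (\<theta> z ^ i * (\<theta> z - 1) ^ j)"
      using br[OF gz] inv[OF \<open>g \<in> \<Gamma>\<close> z(1)] z by (simp add: power_mult_distrib)
    also have "\<dots> = f z ^ r" using br[OF z] by (simp add: dt)
    finally show "(f (moeb g z) * exp (of_nat s / of_nat r * L z)) ^ r = f z ^ r" .
  qed
  show thesis
    by (rule continuous_roots_proportional[OF open_UHP connected_UHP cont contf countable_special assms(2) pw(2,1)])
       (use that in auto)
qed

end

section \<open>Orbits of lifts\<close>

text \<open>The group laws for lifts hold only on the upper half plane, because \<open>moeb\<close> takes junk values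
  where its denominator vanishes. Hence we argue with orbits instead of group elements.\<close>

definition orb :: "lift set \<Rightarrow> complex \<times> complex \<Rightarrow> complex \<times> complex \<Rightarrow> bool" where
  "orb S x y \<longleftrightarrow> (\<exists>\<gamma>\<in>lgen S. lact \<gamma> x = y)"

lemma lact_lmul:
  "mdet (fst h) = 1 \<Longrightarrow> Im (fst x) > 0 \<Longrightarrow> lact (lmul g h) x = lact g (lact h x)"
  by (cases g; cases h; cases x) (simp add: moeb_mmul)

lemma Im_lact: "mdet (fst g) = 1 \<Longrightarrow> Im (fst x) > 0 \<Longrightarrow> Im (fst (lact g x)) > 0"
  by (cases g; cases x) (simp add: Im_moeb)

lemma lact_linv_lact: "mdet (fst g) = 1 \<Longrightarrow> Im (fst x) > 0 \<Longrightarrow> lact (linv g) (lact g x) = x"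
  by (cases g; cases x) (simp add: moeb_minv_moeb)

lemma lact_lact_linv: "mdet (fst g) = 1 \<Longrightarrow> Im (fst x) > 0 \<Longrightarrow> lact g (lact (linv g) x) = x"
  by (cases g; cases x) (simp add: moeb_moeb_minv)

lemma lact_lid [simp]: "lact lid x = x"
  by (cases x) (simp add: lid_def)

lemma mdet_linv [simp]: "mdet (fst (linv g)) = mdet (fst g)"
  by (cases g) simp

lemma mdet_lmul: "mdet (fst (lmul g h)) = mdet (fst g) * mdet (fst h)"
  by (cases g; cases h) (simp add: mdet_mmul)

lemma mdet_lpow: "mdet (fst g) = 1 \<Longrightarrow> mdet (fst (lpow g n)) = 1"
  by (induction n) (simp_all add: mdet_lmul, simp add: lid_def)

lemma mdet_lgen: "g \<in> lgen S \<Longrightarrow> (\<And>s. s \<in> S \<Longrightarrow> mdet (fst s) = 1) \<Longrightarrow> mdet (fst g) = 1"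
  by (induction rule: lgen.induct) (auto simp: mdet_lmul, simp add: lid_def)

lemma lact_lpow: "mdet (fst g) = 1 \<Longrightarrow> Im (fst x) > 0 \<Longrightarrow> lact (lpow g n) x = (lact g ^^ n) x"
  by (induction n) (simp_all add: lact_lmul mdet_lpow)

lemma Im_lact_iter: "mdet (fst g) = 1 \<Longrightarrow> Im (fst x) > 0 \<Longrightarrow> Im (fst ((lact g ^^ n) x)) > 0"
  by (induction n) (simp_all add: Im_lact)

lemma lact_lpow_iter:
  assumes "mdet (fst g) = 1" "Im (fst x) > 0"
  shows "(lact (lpow g n) ^^ k) x = (lact g ^^ (n * k)) x"
proof (induction k)
  case (Suc k)
  then have "(lact (lpow g n) ^^ Suc k) x = lact (lpow g n) ((lact g ^^ (n * k)) x)" by simp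
  also have "\<dots> = (lact g ^^ n) ((lact g ^^ (n * k)) x)"
    by (intro lact_lpow Im_lact_iter assms)
  finally show ?case by (simp add: funpow_add)
qed simp

lemma lact_translate: "lact g (z, u) = (z', u') \<Longrightarrow> lact g (z, u + t) = (z', u' + t)"
  by (cases g) auto

section \<open>Orbit relations of a generated group of lifts\<close>

locale lift_group =
  fixes S :: "lift set"
  assumes mdet_S: "\<And>s. s \<in> S \<Longrightarrow> mdet (fst s) = 1"
begin

lemma mdet_gen: "g \<in> lgen S \<Longrightarrow> mdet (fst g) = 1"
  using mdet_lgen mdet_S by blast

lemma orb_refl: "orb S x x"
  unfolding orb_def using lgen_id lact_lid by blast

lemma orb_step:
  assumes "s \<in> S" "Im (fst x) > 0" "orb S x y"
  shows "orb S x (lact s y)" "orb S x (lact (linv s) y)"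
proof -
  obtain \<gamma> where \<gamma>: "\<gamma> \<in> lgen S" "lact \<gamma> x = y" using assms(3) orb_def by blast
  then have "lact (lmul s \<gamma>) x = lact s y" "lact (lmul (linv s) \<gamma>) x = lact (linv s) y"
    using lact_lmul[OF mdet_gen[OF \<gamma>(1)] assms(2)] by simp_all
  then show "orb S x (lact s y)" "orb S x (lact (linv s) y)"
    unfolding orb_def using lgen_l[OF assms(1) \<gamma>(1)] lgen_li[OF assms(1) \<gamma>(1)] by blast+
qed

lemma orb_trans:
  assumes "Im (fst x) > 0" "orb S x y" "orb S y z"
  shows "orb S x z"
proof -
  have Iy: "Im (fst y) > 0"
    using assms(1,2) Im_lact mdet_gen unfolding orb_def by blast
  have "orb S x (lact \<delta> y)" if "\<delta> \<in> lgen S" for \<delta>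
    using that
  proof induction
    case lgen_id
    then show ?case using assms(2) by simp
  next
    case (lgen_l s g)
    then show ?case using lact_lmul[OF mdet_gen[OF lgen_l(2)] Iy] orb_step(1)[OF _ assms(1)] by simp
  next
    case (lgen_li s g)
    then show ?case using lact_lmul[OF mdet_gen[OF lgen_li(2)] Iy] orb_step(2)[OF _ assms(1)] by simp
  qed
  then show ?thesis using assms(3) unfolding orb_def by blast
qed

lemma orb_sym:
  assumes "Im (fst x) > 0" "orb S x y"
  shows "orb S y x"
proof -
  have "orb S (lact \<delta> x) x" if "\<delta> \<in> lgen S" for \<delta>
    using that
  proof induction
    case lgen_id
    then show ?case by (simp add: orb_refl)
  next
    case (lgen_l s g)
    define w where "w = lact g x"
    have w: "Im (fst w) > 0" unfolding w_def using Im_lact mdet_gen lgen_l assms by blast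
    have "orb S (lact s w) (lact (linv s) (lact s w))"
      using orb_step(2)[OF lgen_l(1) _ orb_refl] Im_lact[OF mdet_S[OF lgen_l(1)] w] by blast
    then have "orb S (lact s w) w" using lact_linv_lact[OF mdet_S[OF lgen_l(1)] w] by simp
    then have "orb S (lact s w) x"
      using orb_trans[OF Im_lact[OF mdet_S[OF lgen_l(1)] w]] lgen_l.IH by (simp add: w_def)
    then show ?case using lact_lmul[OF mdet_gen[OF lgen_l(2)] assms(1)] by (simp add: w_def)
  next
    case (lgen_li s g)
    define w where "w = lact g x"
    have w: "Im (fst w) > 0" unfolding w_def using Im_lact mdet_gen lgen_li assms by blast
    have sw: "Im (fst (lact (linv s) w)) > 0"
      using Im_lact[OF _ w] mdet_S[OF lgen_li(1)] by simp
    have "orb S (lact (linv s) w) (lact s (lact (linv s) w))"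
      using orb_step(1)[OF lgen_li(1) sw orb_refl] .
    then have "orb S (lact (linv s) w) w" using lact_lact_linv[OF mdet_S[OF lgen_li(1)] w] by simp
    then have "orb S (lact (linv s) w) x"
      using orb_trans[OF sw] lgen_li.IH by (simp add: w_def)
    then show ?case using lact_lmul[OF mdet_gen[OF lgen_li(2)] assms(1)] by (simp add: w_def)
  qed
  then show ?thesis using assms(2) unfolding orb_def by blast
qed

text \<open>The action adds a function of z alone to u, so it commutes with translations of the
  fibre.\<close>

lemma orb_translate:
  assumes "orb S (z, u) (z', u')"
  shows "orb S (z, u + t) (z', u' + t)"
  using assms lact_translate unfolding orb_def by blast

lemma orb_iter:
  assumes "s \<in> S" "Im (fst x) > 0"
  shows "orb S x ((lact s ^^ k) x)"
  by (induction k) (simp_all add: orb_refl orb_step assms)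

lemma orb_invariant:
  assumes inv: "\<And>s x. s \<in> S \<Longrightarrow> Im (fst x) > 0 \<Longrightarrow> F (lact s x) = F x"
    and "\<gamma> \<in> lgen S" "Im (fst x) > 0"
  shows "F (lact \<gamma> x) = F x"
  using assms(2)
proof induction
  case lgen_id
  then show ?case by simp
next
  case (lgen_l s g)
  then show ?case
    using lact_lmul[OF mdet_gen[OF lgen_l(2)] assms(3)] inv[OF lgen_l(1)]
      Im_lact[OF mdet_gen[OF lgen_l(2)] assms(3)] by simp
next
  case (lgen_li s g)
  have w: "Im (fst (lact g x)) > 0" using Im_lact[OF mdet_gen[OF lgen_li(2)] assms(3)] .
  \<comment> \<open>Invariance under the inverse is invariance under \<open>s\<close>, applied at
    the point that \<open>s\<close> moves to \<open>lact g x\<close>.\<close>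
  have "F (lact (linv s) (lact g x)) = F (lact s (lact (linv s) (lact g x)))"
    by (rule inv[symmetric, OF lgen_li(1)]) (use Im_lact[OF _ w] mdet_S[OF lgen_li(1)] in simp)
  then show ?case
    using lact_lmul[OF mdet_gen[OF lgen_li(2)] assms(3)] lgen_li.IH
      lact_lact_linv[OF mdet_S[OF lgen_li(1)] w] by simp
qed

lemma orb_int_of_nat:
  assumes "Im z > 0" "\<And>m::nat. orb S (z, 0) (z, c * of_nat m)"
  shows "orb S (z, u) (z, u + c * of_int k)"
proof (cases "k \<ge> 0")
  case True
  then show ?thesis
    using orb_translate[OF assms(2)[of "nat k"], of u] by (simp add: add.commute)
next
  case False
  have "orb S (z, c * of_nat (nat (- k))) (z, 0)"
    using orb_sym[OF _ assms(2)] assms(1) by simp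
  from orb_translate[OF this, of "u + c * of_int k"] False show ?thesis
    by (simp add: algebra_simps)
qed

section \<open>A single lift with central n-th power and generating r-th power\<close>

context
  fixes s :: mat2 and L :: "complex \<Rightarrow> complex" and n r :: nat
  assumes det: "mdet s = 1" and central: "is_c (lpow (s, L) n)"
    and gen: "lpow (s, L) r \<in> S" and cop: "coprime r n" and r0: "0 < r" and n0: "0 < n"
begin

lemma period: "Im z > 0 \<Longrightarrow> (lact (s, L) ^^ (n * m)) (z, u) = (z, u + 2 * of_real pi * \<i> * of_nat m)"
proof (induction m)
  case (Suc m)
  have "(lact (s, L) ^^ n) (z, v) = (z, v + 2 * of_real pi * \<i>)" for v
  proof -
    have "(lact (s, L) ^^ n) (z, v) = lact (lpow (s, L) n) (z, v)"
      using lact_lpow[of "(s, L)" "(z, v)" n] det Suc.prems by simp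
    then show ?thesis
      using central Suc.prems by (cases "lpow (s, L) n") (simp add: is_c_def)
  qed
  with Suc show ?case by (simp add: funpow_add algebra_simps)
qed simp

lemma orb_lift_iter:
  assumes "Im z > 0"
  shows "orb S (z, u) ((lact (s, L) ^^ (r * k)) (z, u))"
  using orb_iter[OF gen, of "(z, u)" k] lact_lpow_iter[of "(s, L)" "(z, u)" k r] det assms by simp

text \<open>With r k = n m + 1, the k-th power of the generator is the lift itself followed by m
  central translations, so its action on the half plane is that of \<open>s\<close>.\<close>

lemma orb_gen:
  assumes "Im z > 0"
  shows "\<exists>u'. orb S (z, u) (moeb s z, u')"
proof -
  obtain k m where "r * k = n * m + 1"
    using bezout_nat[of r n] r0 cop by auto
  then have "(lact (s, L) ^^ (r * k)) (z, u) = lact (s, L) (z, u + 2 * of_real pi * \<i> * of_nat m)"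
    using period[OF assms] by simp
  then show ?thesis
    using orb_lift_iter[OF assms, of u k] by auto
qed

lemma orb_gen_inv:
  assumes "Im z > 0"
  shows "\<exists>u'. orb S (z, u) (moeb (minv s) z, u')"
proof -
  define w where "w = moeb (minv s) z"
  have w: "Im w > 0" using Im_moeb[of "minv s"] det assms by (simp add: w_def)
  obtain u1 where "orb S (w, 0) (moeb s w, u1)" using orb_gen[OF w] by blast
  then have "orb S (z, u1) (w, 0)"
    using orb_sym[of "(w, 0)" "(z, u1)"] w moeb_moeb_minv[OF det assms] by (simp add: w_def)
  from orb_translate[OF this, of "u - u1"] show ?thesis by (auto simp: w_def)
qed

lemma orb_central_nat:
  assumes "Im z > 0"
  shows "orb S (z, u) (z, u + 2 * of_real pi * \<i> * of_nat (r * m))"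
  using orb_lift_iter[OF assms, of u "n * m"] period[OF assms, of "r * m" u] by (simp add: mult_ac)

lemma orb_central:
  assumes "Im z > 0"
  shows "orb S (z, u) (z, u + 2 * of_real pi * \<i> * of_nat r * of_int k)"
  by (rule orb_int_of_nat[OF assms]) (use orb_central_nat[OF assms, of 0] in \<open>simp add: mult_ac\<close>)

text \<open>At a fixed point the lift acts as translation by \<open>L w\<close>, and n such steps
  make the central translation 2 pi i; the r-th power therefore shifts by 2 pi i r / n.\<close>

lemma orb_fixed:
  assumes "Im w > 0" "moeb s w = w"
  shows "orb S (w, u) (w, u + 2 * of_real pi * \<i> * of_nat r / of_nat n * of_int k)"
proof (rule orb_int_of_nat[OF assms(1)])
  have it: "(lact (s, L) ^^ m) (w, v) = (w, v + of_nat m * L w)" for m v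
    by (induction m) (simp_all add: assms(2) algebra_simps)
  have "of_nat n * L w = 2 * of_real pi * \<i>"
    using it[of n 0] period[OF assms(1), of 1 0] by simp
  then have "L w = 2 * of_real pi * \<i> / of_nat n"
    using n0 by (simp add: field_simps)
  then show "orb S (w, 0) (w, 2 * of_real pi * \<i> * of_nat r / of_nat n * of_nat m)" for m
    using orb_lift_iter[OF assms(1), of 0 m] by (simp add: it mult_ac)
qed

end

end

section \<open>The map \<open>\<Psi>\<close>\<close>

lemma power_eq_imp_root_of_unity:
  fixes x y :: complex
  assumes "x ^ n = y ^ n" "0 < n"
  obtains k :: nat where "x * exp (2 * of_real pi * \<i> * of_nat k / of_nat n) = y"
proof (cases "x = 0")
  case True
  then have "y = 0" using assms by (simp add: power_0_left)
  with True that show thesis by simp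
next
  case False
  then have "(y / x) ^ n = 1" using assms(2) by (simp add: power_divide flip: assms(1))
  then obtain k where "y / x = exp (2 * of_real pi * \<i> * of_nat k / of_nat n)"
    using complex_roots_unity[of n] assms(2) by auto
  then show thesis using that[of k] False by (simp add: field_simps)
qed

lemma bij_complex_2x2:
  fixes a b c d :: complex
  assumes "a * d - b * c \<noteq> 0"
  shows "bij (\<lambda>v. (a * fst v + b * snd v, c * fst v + d * snd v))"
proof (rule bijI')
  fix x y :: "complex \<times> complex"
  show "((a * fst x + b * snd x, c * fst x + d * snd x) = (a * fst y + b * snd y, c * fst y + d * snd y)) = (x = y)"
  proof
    assume "(a * fst x + b * snd x, c * fst x + d * snd x) = (a * fst y + b * snd y, c * fst y + d * snd y)"
    then have e: "a * fst x + b * snd x = a * fst y + b * snd y" "c * fst x + d * snd x = c * fst y + d * snd y"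
      by auto
    have "(a * d - b * c) * fst x = d * (a * fst x + b * snd x) - b * (c * fst x + d * snd x)"
      "(a * d - b * c) * snd x = a * (c * fst x + d * snd x) - c * (a * fst x + b * snd x)"
      by (simp_all add: algebra_simps)
    moreover have "(a * d - b * c) * fst y = d * (a * fst y + b * snd y) - b * (c * fst y + d * snd y)"
      "(a * d - b * c) * snd y = a * (c * fst y + d * snd y) - c * (a * fst y + b * snd y)"
      by (simp_all add: algebra_simps)
    ultimately have "(a * d - b * c) * fst x = (a * d - b * c) * fst y"
      "(a * d - b * c) * snd x = (a * d - b * c) * snd y"
      by (simp_all only: e)
    then show "x = y" using assms by (simp add: prod_eq_iff)
  qed simp
next
  fix y :: "complex \<times> complex"
  \<comment> \<open>The preimage below is given by Cramer's rule.\<close>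
  define D where "D = a * d - b * c"
  have D: "D \<noteq> 0" using assms by (simp add: D_def)
  have "a * ((d * fst y - b * snd y) / D) + b * ((a * snd y - c * fst y) / D) = (D * fst y) / D"
    "c * ((d * fst y - b * snd y) / D) + d * ((a * snd y - c * fst y) / D) = (D * snd y) / D"
    unfolding D_def by (simp_all add: add_divide_distrib[symmetric] algebra_simps)
  then show "\<exists>x. y = (a * fst x + b * snd x, c * fst x + d * snd x)"
    using D by (intro exI[of _ "((d * fst y - b * snd y) / D, (a * snd y - c * fst y) / D)"])
      (simp add: prod_eq_iff)
qed

section \<open>The three forms, their zeros and the Jacobian\<close>

locale triangle_forms = triangle_function +
  fixes r :: nat and fa fb finf :: "complex \<Rightarrow> complex" and ca cb :: complex
  assumes cop: "coprime p q" and pq_sum: "r + p + q = p * q" and r0: "0 < r"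
    and surj: "\<And>w. \<exists>z. Im z > 0 \<and> \<theta> z = w"
    and fa: "is_branch r q 1 (q - 1) fa"
    and fb: "is_branch r p (p - 1) 1 fb"
    and finf: "is_branch r (p * q) ((p - 1) * q) (p * (q - 1)) finf"
    and ca: "ca \<noteq> 0" and cb: "cb \<noteq> 0"
    and rel: "\<And>z. Im z > 0 \<Longrightarrow> finf z = ca * fa z ^ p + cb * fb z ^ q"
begin

text \<open>This is where the value of r matters: these are the order counts q (p - 1) = 1 p + r 1
  and p (q - 1) = 1 q + r 1, giving \<open>fa\<close> simple zeros over 0 and \<open>fb\<close>
  simple zeros over 1.\<close>

lemma degree_eqs: "q * (p - 1) = p + r" "p * (q - 1) = q + r"
  using pq_sum p2 q2 by (simp_all add: diff_mult_distrib2 mult.commute)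

lemma coprime_r: "coprime r p" "coprime r q"
proof -
  have "d dvd 1" if "d dvd r" "d dvd p" for d
  proof -
    have "d dvd r + p + q" using pq_sum that(2) by simp
    then have "d dvd q" using that by (metis dvd_add_right_iff dvd_add)
    then show ?thesis using cop that(2) coprime_common_divisor by blast
  qed
  then show "coprime r p" by (rule coprimeI)
  have "d dvd 1" if "d dvd r" "d dvd q" for d
  proof -
    have "d dvd r + p + q" using pq_sum that(2) by simp
    then have "d dvd p" using that by (metis dvd_add_right_iff dvd_add_left_iff)
    then show ?thesis using cop that(2) coprime_common_divisor by blast
  qed
  then show "coprime r q" by (rule coprimeI)
qed

lemma fa_at_0:
  assumes "Im z > 0" "\<theta> z = 0"
  shows "fa z = 0" "deriv fa z \<noteq> 0"
proof -
  have deg: "q * (p - 1) = 1 * p + r * 1"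
    using degree_eqs by simp
  obtain c where c: "c \<noteq> 0" "((\<lambda>w. (fa w / (w - z) ^ 1) ^ r) \<longlongrightarrow> c) (at z)"
    by (rule branch_leading_0[OF fa assms deg])
  show "fa z = 0" "deriv fa z \<noteq> 0"
    using simple_zero_of_leading_coeff[OF branch_derivative[OF fa assms(1)] r0 c] by auto
qed

lemma fb_at_1:
  assumes "Im z > 0" "\<theta> z = 1"
  shows "fb z = 0" "deriv fb z \<noteq> 0"
proof -
  have deg: "p * (q - 1) = 1 * q + r * 1"
    using degree_eqs by simp
  obtain c where c: "c \<noteq> 0" "((\<lambda>w. (fb w / (w - z) ^ 1) ^ r) \<longlongrightarrow> c) (at z)"
    by (rule branch_leading_1[OF fb assms deg])
  show "fb z = 0" "deriv fb z \<noteq> 0"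
    using simple_zero_of_leading_coeff[OF branch_derivative[OF fb assms(1)] r0 c] by auto
qed

lemma branch_nonzero_0:
  assumes "is_branch r s i j f" "Im z > 0" "\<theta> z = 0" "s * (p - 1) = i * p"
  shows "f z \<noteq> 0"
proof -
  have deg: "s * (p - 1) = i * p + r * 0" using assms(4) by simp
  obtain c where c: "c \<noteq> 0" "((\<lambda>w. (f w / (w - z) ^ 0) ^ r) \<longlongrightarrow> c) (at z)"
    by (rule branch_leading_0[OF assms(1-3) deg])
  then show ?thesis
    using nonzero_of_leading_coeff[OF branch_isCont[OF assms(1,2)] r0] by blast
qed

lemma branch_nonzero_1:
  assumes "is_branch r s i j f" "Im z > 0" "\<theta> z = 1" "s * (q - 1) = j * q"
  shows "f z \<noteq> 0"
proof -
  have deg: "s * (q - 1) = j * q + r * 0" using assms(4) by simp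
  obtain c where c: "c \<noteq> 0" "((\<lambda>w. (f w / (w - z) ^ 0) ^ r) \<longlongrightarrow> c) (at z)"
    by (rule branch_leading_1[OF assms(1-3) deg])
  then show ?thesis
    using nonzero_of_leading_coeff[OF branch_isCont[OF assms(1,2)] r0] by blast
qed

lemma fa_nonzero: "Im z > 0 \<Longrightarrow> \<theta> z \<noteq> 0 \<Longrightarrow> fa z \<noteq> 0"
  using branch_nonzero_generic[OF fa r0] branch_nonzero_1[OF fa] by (cases "\<theta> z = 1") auto

lemma fb_nonzero: "Im z > 0 \<Longrightarrow> \<theta> z \<noteq> 1 \<Longrightarrow> fb z \<noteq> 0"
  using branch_nonzero_generic[OF fb r0] branch_nonzero_0[OF fb] by (cases "\<theta> z = 0") auto

lemma finf_nonzero: "Im z > 0 \<Longrightarrow> finf z \<noteq> 0"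
  using branch_nonzero_generic[OF finf r0] branch_nonzero_0[OF finf] branch_nonzero_1[OF finf]
  by (cases "\<theta> z = 0"; cases "\<theta> z = 1") (auto simp: mult_ac)

text \<open>After raising to the power r, the exponents of \<open>\<theta>\<close> in the
  denominators are p on the left and (p - 1) q = p + r in \<open>finf\<close>, while everything else
  agrees. The quotient of the r-th powers is thus the r-th power of \<open>\<theta>\<close>.\<close>

lemma fa_power_ratio:
  obtains \<xi> where "\<xi> \<noteq> 0" "\<And>z. Im z > 0 \<Longrightarrow> fa z ^ p = \<xi> * (\<theta> z * finf z)"
proof -
  have "continuous_on UHP fa" "continuous_on UHP finf" "continuous_on UHP \<theta>"
    using fa finf holo unfolding is_branch_def by (blast intro: holomorphic_on_imp_continuous_on)+
  then have cont: "continuous_on UHP (\<lambda>z. fa z ^ p)" "continuous_on UHP (\<lambda>z. \<theta> z * finf z)"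
    by (auto intro!: continuous_intros)
  have nz: "\<theta> z * finf z \<noteq> 0" if "z \<in> UHP - {z \<in> UHP. \<theta> z = 0 \<or> \<theta> z = 1}" for z
    using that finf_nonzero by auto
  have eq: "(fa z ^ p) ^ r = (\<theta> z * finf z) ^ r" if "z \<in> UHP - {z \<in> UHP. \<theta> z = 0 \<or> \<theta> z = 1}" for z
  proof -
    have z: "z \<in> UHP" "\<theta> z \<noteq> 0" "\<theta> z \<noteq> 1" using that by auto
    have "(fa z ^ p) ^ r = (fa z ^ r) ^ p" by (simp add: mult.commute flip: power_mult)
    also have "\<dots> = deriv \<theta> z ^ (p * q) / (\<theta> z ^ p * (\<theta> z - 1) ^ (p * (q - 1)))"
      using fa z unfolding is_branch_def
      by (simp add: power_divide power_mult_distrib mult.commute flip: power_mult)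
    also have "\<dots> = \<theta> z ^ r * (deriv \<theta> z ^ (p * q) / (\<theta> z ^ ((p - 1) * q) * (\<theta> z - 1) ^ (p * (q - 1))))"
    proof -
      have "(p - 1) * q = p + r" using degree_eqs by (simp add: mult.commute)
      then show ?thesis using z by (simp add: power_add)
    qed
    also have "\<dots> = (\<theta> z * finf z) ^ r"
      using finf z unfolding is_branch_def by (simp add: power_mult_distrib)
    finally show ?thesis .
  qed
  show thesis
  proof (rule continuous_roots_proportional[OF open_UHP connected_UHP cont countable_special r0 nz eq])
    fix c assume "c ^ r = 1" and c: "\<And>z. z \<in> UHP \<Longrightarrow> fa z ^ p = c * (\<theta> z * finf z)"
    then have "c \<noteq> 0" using r0 by (auto simp: power_0_left)
    then show thesis using that c by simp
  qed
qed

text \<open>Up to an exponential factor and 1 / r this is the Jacobian determinant of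
  \<open>\<Psi>\<close>. Over 0 and 1 a simple zero leaves one nonzero term. Elsewhere the
  logarithmic derivative of the identity \<open>id\<close> expresses it through the derivative of
  \<open>\<theta>\<close>.\<close>

lemma wronskian_nonzero:
  assumes z: "Im z > 0"
  shows "of_nat q * deriv fb z * fa z - of_nat p * fb z * deriv fa z \<noteq> 0"
proof (cases "\<theta> z = 0 \<or> \<theta> z = 1")
  case True
  then show ?thesis
    using fa_at_0[OF z] fb_at_1[OF z] fa_nonzero[OF z] fb_nonzero[OF z] p2 q2 by auto
next
  case False
  obtain \<xi> where \<xi>: "\<xi> \<noteq> 0" "\<And>z. Im z > 0 \<Longrightarrow> fa z ^ p = \<xi> * (\<theta> z * finf z)"
    using fa_power_ratio by blast
  \<comment> \<open>Eliminating \<open>finf\<close> between \<open>rel\<close> and the ratio formula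
    leaves a relation in \<open>fa\<close>, \<open>fb\<close> and \<open>\<theta>\<close>
    only.\<close>
  have id: "fa w ^ p * (1 - ca * \<xi> * \<theta> w) = \<xi> * cb * (\<theta> w * fb w ^ q)" if "Im w > 0" for w
  proof -
    have "cb * fb w ^ q = finf w - ca * fa w ^ p" using rel[OF that] by simp
    also have "\<dots> = finf w * (1 - ca * \<xi> * \<theta> w)"
      using \<xi>(2)[OF that] by (simp add: algebra_simps)
    finally have "cb * fb w ^ q = finf w * (1 - ca * \<xi> * \<theta> w)" .
    then have "\<xi> * cb * (\<theta> w * fb w ^ q) = \<xi> * \<theta> w * (finf w * (1 - ca * \<xi> * \<theta> w))"
      by (simp add: mult_ac)
    from this[symmetric] show ?thesis unfolding \<xi>(2)[OF that] by (simp only: mult.assoc)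
  qed
  note d = branch_derivative[OF fa z] branch_derivative[OF fb z] theta_has_derivative[OF z]
  have D1: "((\<lambda>w. fa w ^ p * (1 - ca * \<xi> * \<theta> w)) has_field_derivative
     of_nat p * (deriv fa z * fa z ^ (p - 1)) * (1 - ca * \<xi> * \<theta> z) - fa z ^ p * (ca * \<xi> * deriv \<theta> z)) (at z)"
    by (rule derivative_eq_intros d refl)+ (simp add: algebra_simps)
  have D2: "((\<lambda>w. \<xi> * cb * (\<theta> w * fb w ^ q)) has_field_derivative
     \<xi> * cb * (deriv \<theta> z * fb z ^ q + \<theta> z * (of_nat q * (deriv fb z * fb z ^ (q - 1))))) (at z)"
    by (rule derivative_eq_intros d refl)+ (simp add: algebra_simps)
  have "eventually (\<lambda>w. fa w ^ p * (1 - ca * \<xi> * \<theta> w) = \<xi> * cb * (\<theta> w * fb w ^ q)) (nhds z)"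
    using eventually_nhds_in_open[OF open_UHP, of z] z by (auto elim!: eventually_mono intro!: id)
  from deriv_eqI_eventually[OF D1 this] DERIV_imp_deriv[OF D2]
  have e: "of_nat p * (deriv fa z * fa z ^ (p - 1)) * (1 - ca * \<xi> * \<theta> z) - fa z ^ p * (ca * \<xi> * deriv \<theta> z)
     = \<xi> * cb * (deriv \<theta> z * fb z ^ q + \<theta> z * (of_nat q * (deriv fb z * fb z ^ (q - 1))))"
    by simp
  have pw: "fa z * fa z ^ (p - 1) = fa z ^ p" "fb z * fb z ^ (q - 1) = fb z ^ q"
    using p2 q2 by (simp_all flip: power_Suc)
  define X where "X = fa z ^ p * (1 - ca * \<xi> * \<theta> z)"
  have X: "\<xi> * cb * (\<theta> z * fb z ^ q) = X" using id[OF z] by (simp add: X_def)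
  \<comment> \<open>Multiplying the differentiated relation by
    \<open>fa z * fb z * \<theta> z\<close> restores the lowered exponents, so that both sides
    become expressions in the common value \<open>X\<close>.\<close>
  have "fa z * fb z * \<theta> z * (of_nat p * (deriv fa z * fa z ^ (p - 1)) * (1 - ca * \<xi> * \<theta> z)
        - fa z ^ p * (ca * \<xi> * deriv \<theta> z))
      = of_nat p * fb z * deriv fa z * \<theta> z * ((fa z * fa z ^ (p - 1)) * (1 - ca * \<xi> * \<theta> z))
        - deriv \<theta> z * fa z * fb z * (ca * \<xi> * \<theta> z * fa z ^ p)"
    by (simp add: algebra_simps)
  also have "\<dots> = of_nat p * fb z * deriv fa z * \<theta> z * X - deriv \<theta> z * fa z * fb z * (fa z ^ p - X)"
    unfolding pw by (simp add: X_def algebra_simps)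
  finally have l: "fa z * fb z * \<theta> z * (of_nat p * (deriv fa z * fa z ^ (p - 1)) * (1 - ca * \<xi> * \<theta> z)
        - fa z ^ p * (ca * \<xi> * deriv \<theta> z))
      = of_nat p * fb z * deriv fa z * \<theta> z * X - deriv \<theta> z * fa z * fb z * (fa z ^ p - X)" .
  have "fa z * fb z * \<theta> z * (\<xi> * cb * (deriv \<theta> z * fb z ^ q + \<theta> z * (of_nat q * (deriv fb z * fb z ^ (q - 1)))))
      = deriv \<theta> z * fa z * fb z * (\<xi> * cb * (\<theta> z * fb z ^ q))
        + of_nat q * deriv fb z * fa z * \<theta> z * (\<xi> * cb * (\<theta> z * (fb z * fb z ^ (q - 1))))"
    by (simp add: algebra_simps)
  also have "\<dots> = deriv \<theta> z * fa z * fb z * X + of_nat q * deriv fb z * fa z * \<theta> z * X"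
    unfolding pw X ..
  finally have "of_nat p * fb z * deriv fa z * \<theta> z * X - deriv \<theta> z * fa z * fb z * (fa z ^ p - X)
     = deriv \<theta> z * fa z * fb z * X + of_nat q * deriv fb z * fa z * \<theta> z * X"
    using e l by simp
  then have "(of_nat q * deriv fb z * fa z - of_nat p * fb z * deriv fa z) * (\<theta> z * X)
     = - (deriv \<theta> z * fa z * fb z * fa z ^ p)"
    by (simp add: algebra_simps)
  moreover have "deriv \<theta> z * fa z * fb z * fa z ^ p \<noteq> 0"
    using deriv_theta_nonzero[OF z] fa_nonzero[OF z] fb_nonzero[OF z] False by simp
  ultimately show ?thesis by auto
qed

section \<open>Image and differential of the map\<close>

definition \<Psi> :: "complex \<times> complex \<Rightarrow> complex \<times> complex" where
  "\<Psi> x = (fb (fst x) * exp (of_nat p / of_nat r * snd x), fa (fst x) * exp (of_nat q / of_nat r * snd x))"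

lemma \<Psi>_relation:
  assumes "Im z > 0"
  shows "cb * fst (\<Psi> (z, u)) ^ q + ca * snd (\<Psi> (z, u)) ^ p
     = finf z * exp (of_nat p * of_nat q / of_nat r * u)"
proof -
  have "exp (of_nat p / of_nat r * u) ^ q = exp (of_nat p * of_nat q / of_nat r * u)"
    "exp (of_nat q / of_nat r * u) ^ p = exp (of_nat p * of_nat q / of_nat r * u)"
    by (simp_all add: mult_ac flip: exp_of_nat_mult)
  then show ?thesis
    using rel[OF assms] by (simp add: \<Psi>_def power_mult_distrib algebra_simps)
qed

text \<open>The exponential factors cancel in the ratio of the p-th power of the second component to
  the equation of the excluded curve, so this ratio recovers \<open>\<theta>\<close> up to
  \<open>\<xi>\<close>. The denominator \<open>M\<close> is nonzero because \<open>finf\<close> has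
  no zeros.\<close>

lemma \<Psi>_theta:
  assumes "Im z > 0" "Im z' > 0" "\<Psi> (z, u) = \<Psi> (z', u')"
  shows "\<theta> z = \<theta> z'"
proof -
  obtain \<xi> where \<xi>: "\<xi> \<noteq> 0" "\<And>z. Im z > 0 \<Longrightarrow> fa z ^ p = \<xi> * (\<theta> z * finf z)"
    using fa_power_ratio by blast
  have *: "snd (\<Psi> (z, u)) ^ p = \<xi> * \<theta> z * (cb * fst (\<Psi> (z, u)) ^ q + ca * snd (\<Psi> (z, u)) ^ p)"
    if "Im z > 0" for z u
  proof -
    have "exp (of_nat q / of_nat r * u) ^ p = exp (of_nat p * of_nat q / of_nat r * u)"
      by (simp_all add: mult_ac flip: exp_of_nat_mult)
    then have "snd (\<Psi> (z, u)) ^ p = fa z ^ p * exp (of_nat p * of_nat q / of_nat r * u)"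
      by (simp add: \<Psi>_def power_mult_distrib)
    then show ?thesis unfolding \<Psi>_relation[OF that] using \<xi>(2)[OF that] by simp
  qed
  define M where "M = cb * fst (\<Psi> (z, u)) ^ q + ca * snd (\<Psi> (z, u)) ^ p"
  have "M \<noteq> 0"
    unfolding M_def \<Psi>_relation[OF assms(1)] using finf_nonzero[OF assms(1)] by simp
  moreover have "\<xi> * \<theta> z * M = \<xi> * \<theta> z' * M"
    using *[OF assms(1), of u] *[OF assms(2), of u'] unfolding assms(3)[symmetric] M_def[symmetric]
    by (rule subst)
  ultimately show ?thesis using \<xi>(1) by simp
qed

text \<open>The required value of \<open>\<theta>\<close> is forced by the ratio formula, and u is
  then adjusted by a logarithm. This matches \<open>v1 ^ q\<close> and \<open>v2 ^ p\<close>; a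
  further shift of u corrects the two roots of unity simultaneously.\<close>

lemma \<Psi>_surj:
  assumes "cb * v1 ^ q + ca * v2 ^ p \<noteq> 0"
  shows "\<exists>z u. Im z > 0 \<and> \<Psi> (z, u) = (v1, v2)"
proof -
  define N where "N = cb * v1 ^ q + ca * v2 ^ p"
  obtain \<xi> where \<xi>: "\<xi> \<noteq> 0" "\<And>z. Im z > 0 \<Longrightarrow> fa z ^ p = \<xi> * (\<theta> z * finf z)"
    using fa_power_ratio by blast
  obtain z where z: "Im z > 0" "\<theta> z = v2 ^ p / (N * \<xi>)" using surj by blast
  \<comment> \<open>The choice makes \<open>N\<close>, the prescribed value of the curve equation,
    equal to \<open>finf z\<close> times the exponential factor in
    \<open>\<Psi>_relation\<close>.\<close>
  define u where "u = of_nat r / (of_nat p * of_nat q) * Ln (N / finf z)"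
  have N: "N \<noteq> 0" using assms by (simp add: N_def)
  have "of_nat p * of_nat q / of_nat r * u = Ln (N / finf z)"
    using p2 q2 r0 by (simp add: u_def)
  then have ex: "exp (of_nat p * of_nat q / of_nat r * u) = N / finf z"
    using N finf_nonzero[OF z(1)] by simp
  have "exp (of_nat q / of_nat r * u) ^ p = exp (of_nat p * of_nat q / of_nat r * u)"
    by (simp_all add: mult_ac flip: exp_of_nat_mult)
  then have "(fa z * exp (of_nat q / of_nat r * u)) ^ p = fa z ^ p * (N / finf z)"
    by (simp only: power_mult_distrib ex)
  then have 2: "(fa z * exp (of_nat q / of_nat r * u)) ^ p = v2 ^ p"
    using \<xi> z N finf_nonzero[OF z(1)] by simp
  have "cb * (fb z * exp (of_nat p / of_nat r * u)) ^ q + ca * (fa z * exp (of_nat q / of_nat r * u)) ^ p = N"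
    using \<Psi>_relation[OF z(1), of u] finf_nonzero[OF z(1)] ex by (simp add: \<Psi>_def)
  then have 1: "(fb z * exp (of_nat p / of_nat r * u)) ^ q = v1 ^ q"
    using 2 cb by (simp add: N_def)
  obtain k1 k2 where k1: "fb z * exp (of_nat p / of_nat r * u) * exp (2 * of_real pi * \<i> * of_nat k1 / of_nat q) = v1"
    and k2: "fa z * exp (of_nat q / of_nat r * u) * exp (2 * of_real pi * \<i> * of_nat k2 / of_nat p) = v2"
    using power_eq_imp_root_of_unity[OF 1] power_eq_imp_root_of_unity[OF 2] p2 q2
    by (metis less_le_trans zero_less_numeral)
  obtain m where m: "[m = k2] (mod p)" "[m = k1] (mod q)"
    using binary_chinese_remainder_nat[OF cop] by blast
  \<comment> \<open>The shift multiplies the components by the m-th powers of the standard q-th and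
    p-th roots of unity; the Chinese remainder theorem provides one m for both.\<close>
  define u' where "u' = u + 2 * of_real pi * \<i> * of_nat r * of_nat m / (of_nat p * of_nat q)"
  have "of_nat p / of_nat r * u' = of_nat p / of_nat r * u + 2 * of_real pi * \<i> * of_nat m / of_nat q"
    "of_nat q / of_nat r * u' = of_nat q / of_nat r * u + 2 * of_real pi * \<i> * of_nat m / of_nat p"
    using p2 q2 r0 by (simp_all add: u'_def distrib_left)
  moreover have "exp (2 * of_real pi * \<i> * of_nat m / of_nat q) = exp (2 * of_real pi * \<i> * of_nat k1 / of_nat q)"
    "exp (2 * of_real pi * \<i> * of_nat m / of_nat p) = exp (2 * of_real pi * \<i> * of_nat k2 / of_nat p)"
    using m p2 q2 complex_root_unity_eq[of q m k1] complex_root_unity_eq[of p m k2] by (simp_all add: cong_def)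
  ultimately have "\<Psi> (z, u') = (v1, v2)"
    using k1 k2 by (simp add: \<Psi>_def exp_add mult.assoc)
  then show ?thesis using z(1) by blast
qed

lemma \<Psi>_derivative:
  assumes z: "Im z > 0"
  shows "\<exists>D. (\<Psi> has_derivative D) (at (z, u)) \<and> clinear2 D \<and> bij D"
proof -
  define P where "P = (of_nat p / of_nat r :: complex)"
  define Q where "Q = (of_nat q / of_nat r :: complex)"
  define D where "D = (\<lambda>v. (exp (P * u) * deriv fb z * fst v + exp (P * u) * P * fb z * snd v,
     exp (Q * u) * deriv fa z * fst v + exp (Q * u) * Q * fa z * snd v))"
  have comp: "((\<lambda>x. f (fst x) * exp (k * snd x)) has_derivative
     (\<lambda>v. exp (k * u) * deriv f z * fst v + exp (k * u) * k * f z * snd v)) (at (z, u))"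
    if "(f has_field_derivative deriv f z) (at z)" for f k
  proof -
    have "(f has_derivative (\<lambda>h. deriv f z * h)) (at (fst (z, u)))"
      using that by (simp add: has_field_derivative_def)
    from has_derivative_compose[OF has_derivative_fst[OF has_derivative_ident] this]
    have 1: "((\<lambda>x. f (fst x)) has_derivative (\<lambda>v. deriv f z * fst v)) (at (z, u))" .
    have "((\<lambda>w. exp (k * w)) has_field_derivative exp (k * u) * k) (at u)"
      by (rule derivative_eq_intros refl)+ simp
    then have "((\<lambda>w. exp (k * w)) has_derivative (\<lambda>h. exp (k * u) * k * h)) (at (snd (z, u)))"
      by (simp add: has_field_derivative_def)
    from has_derivative_compose[OF has_derivative_snd[OF has_derivative_ident] this]
    have 2: "((\<lambda>x. exp (k * snd x)) has_derivative (\<lambda>v. exp (k * u) * k * snd v)) (at (z, u))" .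
    from has_derivative_mult[OF 1 2] show ?thesis
      by (simp add: algebra_simps)
  qed
  have "(\<Psi> has_derivative D) (at (z, u))"
    unfolding D_def \<Psi>_def P_def[symmetric] Q_def[symmetric]
    by (intro has_derivative_Pair comp branch_derivative[OF fa z] branch_derivative[OF fb z])
  moreover have "clinear2 D"
    unfolding clinear2_def
    using has_derivative_linear[OF calculation] by (simp add: D_def algebra_simps)
  moreover have "bij D"
    unfolding D_def
  proof (rule bij_complex_2x2)
    \<comment> \<open>The determinant is the expression of \<open>wronskian_nonzero\<close> times a
      nonvanishing factor.\<close>
    have "exp (P * u) * deriv fb z * (exp (Q * u) * Q * fa z) - exp (P * u) * P * fb z * (exp (Q * u) * deriv fa z)
       = exp (P * u) * exp (Q * u) / of_nat r * (of_nat q * deriv fb z * fa z - of_nat p * fb z * deriv fa z)"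
      by (simp add: P_def Q_def algebra_simps diff_divide_distrib)
    then show "exp (P * u) * deriv fb z * (exp (Q * u) * Q * fa z)
        - exp (P * u) * P * fb z * (exp (Q * u) * deriv fa z) \<noteq> 0"
      using wronskian_nonzero[OF z] r0 by simp
  qed
  ultimately show ?thesis by blast
qed

text \<open>A lift multiplies \<open>f\<close> by an \<open>r\<close>-th root of unity, which its \<open>r\<close>-th power kills.\<close>

lemma branch_lift_power:
  assumes f: "is_branch r s i j f" and lift: "is_lift (g, L)" and g: "g \<in> \<Gamma>" and x: "Im (fst x) > 0"
  shows "f (fst (lact (lpow (g, L) r) x)) * exp (of_nat s / of_nat r * snd (lact (lpow (g, L) r) x))
    = f (fst x) * exp (of_nat s / of_nat r * snd x)"
proof -
  define F where "F x = f (fst x) * exp (of_nat s / of_nat r * snd x)" for x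
  obtain c where c: "c ^ r = 1"
    "\<And>z. Im z > 0 \<Longrightarrow> f (moeb g z) * exp (of_nat s / of_nat r * L z) = c * f z"
    using branch_character[OF f r0 lift g] by blast
  have dg: "mdet g = 1" using g mdet_Gamma by blast
  have step: "F (lact (g, L) y) = c * F y" if "Im (fst y) > 0" for y
  proof -
    obtain z u where y: "y = (z, u)" by (cases y)
    have "F (lact (g, L) y) = f (moeb g z) * exp (of_nat s / of_nat r * L z) * exp (of_nat s / of_nat r * u)"
      by (simp only: F_def y lact.simps fst_conv snd_conv distrib_left distrib_right exp_add mult_ac)
    also have "\<dots> = c * F y" using c(2)[of z] that by (simp add: F_def y)
    finally show ?thesis .
  qed
  have "F ((lact (g, L) ^^ n) x) = c ^ n * F x" for n
    by (induction n) (use Im_lact_iter[of "(g, L)" x] dg x in \<open>simp_all add: step\<close>)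
  then have "F (lact (lpow (g, L) r) x) = F x"
    using lact_lpow[of "(g, L)" x r] dg x c(1) by simp
  then show ?thesis by (simp add: F_def)
qed

end

section \<open>Fibres of the map are orbits of the group\<close>

locale triangle_lifts = triangle_forms +
  fixes La Lb :: "complex \<Rightarrow> complex"
  assumes lifta: "is_lift (A, La)" and liftb: "is_lift (B, Lb)"
    and cena: "is_c (lpow (A, La) p)" and cenb: "is_c (lpow (B, Lb) q)"
begin

definition gens :: "lift set" where
  "gens = {lpow (A, La) r, lpow (B, Lb) r}"

sublocale lift_group gens
  by standard (auto simp: gens_def intro!: mdet_lpow)

lemma \<Psi>_invariant:
  assumes "\<gamma> \<in> lgen gens" "Im (fst x) > 0"
  shows "\<Psi> (lact \<gamma> x) = \<Psi> x"
proof (rule orb_invariant[OF _ assms])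
  fix s and y :: "complex \<times> complex"
  assume "s \<in> gens" and y: "Im (fst y) > 0"
  then show "\<Psi> (lact s y) = \<Psi> y"
    using branch_lift_power[OF fa lifta A0_Gamma y] branch_lift_power[OF fb lifta A0_Gamma y]
      branch_lift_power[OF fa liftb B0_Gamma y] branch_lift_power[OF fb liftb B0_Gamma y]
    by (auto simp: gens_def \<Psi>_def)
qed

lemma gens_mem: "lpow (A, La) r \<in> gens" "lpow (B, Lb) r \<in> gens"
  by (simp_all add: gens_def)

lemma pos: "0 < p" "0 < q"
  using p2 q2 by auto

lemmas a_facts = mdet_A0 cena gens_mem(1) coprime_r(1) r0 pos(1)
lemmas b_facts = mdet_B0 cenb gens_mem(2) coprime_r(2) r0 pos(2)

text \<open>When the fibre coordinate is left free, the r-th powers already realize all of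
  \<open>\<Gamma>\<close>: by coprimality each generator and its inverse is reached up to a central
  translation.\<close>

lemma orb_Gamma:
  assumes "g \<in> \<Gamma>" "Im z > 0"
  shows "\<exists>u'. orb gens (z, u) (moeb g z, u')"
  using assms(1) unfolding Gamma_pq_def
proof induction
  case mgen_id
  then show ?case using orb_refl by auto
next
  case (mgen_l s g)
  have dg: "mdet g = 1" using mgen_l(2) mdet_Gamma[of g p q] by (simp add: Gamma_pq_def)
  have gz: "Im (moeb g z) > 0" using Im_moeb[OF dg assms(2)] .
  obtain u1 where "orb gens (z, u) (moeb g z, u1)" using mgen_l.IH by blast
  moreover obtain u2 where "orb gens (moeb g z, u1) (moeb s (moeb g z), u2)"
    using orb_gen[OF a_facts gz] orb_gen[OF b_facts gz] mgen_l(1) by blast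
  ultimately have "orb gens (z, u) (moeb s (moeb g z), u2)"
    using orb_trans[of "(z, u)"] assms(2) by simp
  then show ?case using moeb_mmul[OF dg assms(2)] by auto
next
  case (mgen_li s g)
  have dg: "mdet g = 1" using mgen_li(2) mdet_Gamma[of g p q] by (simp add: Gamma_pq_def)
  have gz: "Im (moeb g z) > 0" using Im_moeb[OF dg assms(2)] .
  obtain u1 where "orb gens (z, u) (moeb g z, u1)" using mgen_li.IH by blast
  moreover obtain u2 where "orb gens (moeb g z, u1) (moeb (minv s) (moeb g z), u2)"
    using orb_gen_inv[OF a_facts gz] orb_gen_inv[OF b_facts gz] mgen_li(1) by blast
  ultimately have "orb gens (z, u) (moeb (minv s) (moeb g z), u2)"
    using orb_trans[of "(z, u)"] assms(2) by simp
  then show ?case using moeb_mmul[OF dg assms(2)] by auto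
qed

text \<open>Move from z to w, translate there, and move back; the way back is available at the
  shifted height since the action commutes with fibre translations.\<close>

lemma orb_conj:
  assumes "Im z > 0" "Im w > 0" "\<theta> z = \<theta> w" "\<And>v. orb gens (w, v) (w, v + t)"
  shows "orb gens (z, u) (z, u + t)"
proof -
  obtain g where "g \<in> \<Gamma>" "moeb g z = w" using sep assms by blast
  then obtain v where v: "orb gens (z, u) (w, v)" using orb_Gamma assms(1) by metis
  have "orb gens (w, v + t) (z, u + t)"
    using orb_translate[OF orb_sym[OF _ v]] assms(1) by simp
  then show ?thesis
    using orb_trans[OF _ orb_trans[OF _ v assms(4)]] assms(1) by simp
qed

text \<open>Each nonvanishing component fixes u modulo its period. Over 0 only 2 pi i r / p remains,
  over 1 only 2 pi i r / q, and these are the shifts of \<open>orb_fixed\<close> at the model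
  points, transported by \<open>orb_conj\<close>.\<close>

lemma orb_same_fibre:
  assumes z: "Im z > 0" and eq: "\<Psi> (z, u) = \<Psi> (z, u')"
  shows "orb gens (z, u) (z, u')"
proof -
  have ex: "\<exists>k. u' = u + 2 * of_real pi * \<i> * of_nat r / of_nat n * of_int k"
    if "exp (of_nat n / of_nat r * u) = exp (of_nat n / of_nat r * u')" "0 < n" for n :: nat
  proof -
    from that(1) obtain k :: int where
      k: "of_nat n / of_nat r * u' = of_nat n / of_nat r * u + of_int (2 * k) * of_real pi * \<i>"
      using exp_eq[of "of_nat n / of_nat r * u'" "of_nat n / of_nat r * u"] by auto
    have "u' = of_nat r / of_nat n * (of_nat n / of_nat r * u')" using r0 that(2) by simp
    also have "\<dots> = u + 2 * of_real pi * \<i> * of_nat r / of_nat n * of_int k"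
      unfolding k using r0 that(2) by (simp add: distrib_left)
    finally show ?thesis by blast
  qed
  have ea: "\<theta> z \<noteq> 0 \<Longrightarrow> exp (of_nat q / of_nat r * u) = exp (of_nat q / of_nat r * u')"
    and eb: "\<theta> z \<noteq> 1 \<Longrightarrow> exp (of_nat p / of_nat r * u) = exp (of_nat p / of_nat r * u')"
    using eq fa_nonzero[OF z] fb_nonzero[OF z] by (auto simp: \<Psi>_def)
  consider "\<theta> z = 0" | "\<theta> z = 1" | "\<theta> z \<noteq> 0" "\<theta> z \<noteq> 1" by blast
  then show ?thesis
  proof cases
    case 1
    then obtain k where "u' = u + 2 * of_real pi * \<i> * of_nat r / of_nat p * of_int k"
      using ex[OF eb pos(1)] by auto
    then show ?thesis
      using orb_conj[OF z Im_fix(1)[OF p2] _ orb_fixed[OF a_facts Im_fix(1)[OF p2] moeb_fixA]]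
        1 theta_fixA by simp
  next
    case 2
    then obtain k where "u' = u + 2 * of_real pi * \<i> * of_nat r / of_nat q * of_int k"
      using ex[OF ea pos(2)] by auto
    then show ?thesis
      using orb_conj[OF z Im_fix(2)[OF q2] _ orb_fixed[OF b_facts Im_fix(2)[OF q2] moeb_fixB]]
        2 theta_fixB by simp
  next
    case 3
    obtain k where k: "u' = u + 2 * of_real pi * \<i> * of_nat r / of_nat p * of_int k"
      using ex[OF eb pos(1)] 3 by auto
    obtain l where l: "u' = u + 2 * of_real pi * \<i> * of_nat r / of_nat q * of_int l"
      using ex[OF ea pos(2)] 3 by auto
    \<comment> \<open>At a generic point the difference is a multiple of both periods; coprimality
      of p and q makes it a multiple of 2 pi i r, the shift of \<open>orb_central\<close>.\<close>
    have "2 * of_real pi * \<i> * of_nat r / of_nat p * of_int k = 2 * of_real pi * \<i> * of_nat r / of_nat q * of_int l"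
      using k l by simp
    then have "complex_of_int k * of_nat q = of_int l * of_nat p"
      using pos r0 by (simp add: field_simps)
    then have "complex_of_int (k * int q) = of_int (l * int p)" by simp
    then have "k * int q = l * int p" by (simp only: of_int_eq_iff)
    then have "int p dvd k * int q" by simp
    then have "int p dvd k"
      using cop by (simp add: coprime_dvd_mult_left_iff)
    then obtain m where "k = int p * m" by blast
    then have "u' = u + 2 * of_real pi * \<i> * of_nat r * of_int m"
      using k pos by simp
    then show ?thesis using orb_central[OF a_facts z] by simp
  qed
qed

lemma \<Psi>_injective:
  assumes "Im z > 0" "Im z' > 0" "\<Psi> (z, u) = \<Psi> (z', u')"
  shows "orb gens (z, u) (z', u')"
proof -
  obtain g where "g \<in> \<Gamma>" "moeb g z = z'"
    using sep[OF assms(1,2) \<Psi>_theta[OF assms]] by blast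
  then obtain v where v: "orb gens (z, u) (z', v)" using orb_Gamma assms(1) by metis
  then have "\<Psi> (z', v) = \<Psi> (z, u)"
    using \<Psi>_invariant assms(1) unfolding orb_def by force
  then have "orb gens (z', v) (z', u')"
    using orb_same_fibre[OF assms(2)] assms(3) by simp
  then show ?thesis using orb_trans[OF _ v] assms(1) by simp
qed

end

text \<open>Biholomorphy of the induced map is expressed upstairs: fibres are exactly the orbits,
  every point off the curve is attained, and the differential is everywhere a complex linear
  isomorphism, so \<open>\<Psi>\<close> is locally biholomorphic.\<close>

theorem mainTheorem1:
  fixes p q r :: nat
    and \<theta> fa fb finf :: "complex \<Rightarrow> complex"
    and La Lb :: "complex \<Rightarrow> complex"
    and ca cb :: complex
    and G :: "lift set"
    and \<Psi> :: "complex \<times> complex \<Rightarrow> complex \<times> complex"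
  assumes pq: "2 \<le> p" "p < q" "coprime p q"
    and r_def: "r = p * q - p - q"
    and theta_holo: "\<theta> holomorphic_on UHP"
    and theta_inv: "\<forall>g\<in>Gamma_pq p q. \<forall>z\<in>UHP. \<theta> (moeb g z) = \<theta> z"
    and theta_surj: "\<forall>w. \<exists>z\<in>UHP. \<theta> z = w"
    and theta_inj: "\<forall>z\<in>UHP. \<forall>z'\<in>UHP. \<theta> z = \<theta> z' \<longrightarrow> (\<exists>g\<in>Gamma_pq p q. moeb g z = z')"
    and theta_a: "\<theta> (Complex (- cos (pi / real p)) (sin (pi / real p))) = 0"
    and theta_b: "\<theta> (Complex (cos (pi / real q)) (sin (pi / real q))) = 1"
    and fa_holo: "fa holomorphic_on UHP"
    and fa_branch: "\<forall>z\<in>UHP. \<theta> z \<noteq> 0 \<and> \<theta> z \<noteq> 1 \<longrightarrow>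
        fa z ^ r = (deriv \<theta> z) ^ q / (\<theta> z * (\<theta> z - 1) ^ (q - 1))"
    and fb_holo: "fb holomorphic_on UHP"
    and fb_branch: "\<forall>z\<in>UHP. \<theta> z \<noteq> 0 \<and> \<theta> z \<noteq> 1 \<longrightarrow>
        fb z ^ r = (deriv \<theta> z) ^ p / (\<theta> z ^ (p - 1) * (\<theta> z - 1))"
    and finf_holo: "finf holomorphic_on UHP"
    and finf_branch: "\<forall>z\<in>UHP. \<theta> z \<noteq> 0 \<and> \<theta> z \<noteq> 1 \<longrightarrow>
        finf z ^ r = (deriv \<theta> z) ^ (p * q) / (\<theta> z ^ ((p - 1) * q) * (\<theta> z - 1) ^ (p * (q - 1)))"
    and c_nz: "ca \<noteq> 0" "cb \<noteq> 0"
    and c_rel: "\<forall>z\<in>UHP. finf z = ca * fa z ^ p + cb * fb z ^ q"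
    and alpha_lift: "is_lift (A0 p, La)" "is_c (lpow (A0 p, La) p)"
    and beta_lift: "is_lift (B0 q, Lb)" "is_c (lpow (B0 q, Lb) q)"
    and G_def: "G = lgen {lpow (A0 p, La) r, lpow (B0 q, Lb) r}"
    and Psi_def: "\<And>z u. \<Psi> (z, u) =
        (fb z * exp (of_nat p / of_nat r * u), fa z * exp (of_nat q / of_nat r * u))"
  shows "(\<forall>\<gamma>\<in>G. \<forall>x\<in>UHP \<times> UNIV. \<Psi> (lact \<gamma> x) = \<Psi> x)
       \<and> (\<forall>x\<in>UHP \<times> UNIV. cb * fst (\<Psi> x) ^ q + ca * snd (\<Psi> x) ^ p \<noteq> 0)
       \<and> (\<forall>x\<in>UHP \<times> UNIV. \<forall>y\<in>UHP \<times> UNIV. \<Psi> x = \<Psi> y \<longrightarrow> (\<exists>\<gamma>\<in>G. lact \<gamma> x = y))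
       \<and> (\<forall>v. cb * fst v ^ q + ca * snd v ^ p \<noteq> 0 \<longrightarrow> (\<exists>x\<in>UHP \<times> UNIV. \<Psi> x = v))
       \<and> (\<forall>x\<in>UHP \<times> UNIV. \<exists>D. (\<Psi> has_derivative D) (at x) \<and> clinear2 D \<and> bij D)"
proof -
  have q2: "2 \<le> q" using pq by simp
  \<comment> \<open>Together with p < q this gives p + q < p q, so the truncated subtractions in the
    definition of r are exact and r is positive.\<close>
  have "2 * q \<le> p * q" using pq(1) by simp
  then have rpq: "r + p + q = p * q" "0 < r"
    using pq(2) r_def by linarith+
  interpret F: triangle_function p q \<theta>
    by unfold_locales (use pq q2 theta_inv theta_a theta_b theta_holo theta_inj in auto)
  have br: "F.is_branch r q 1 (q - 1) fa" "F.is_branch r p (p - 1) 1 fb"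
    "F.is_branch r (p * q) ((p - 1) * q) (p * (q - 1)) finf"
    using fa_holo fa_branch fb_holo fb_branch finf_holo finf_branch
    unfolding F.is_branch_def by simp_all
  interpret T: triangle_lifts p q \<theta> r fa fb finf ca cb La Lb
  proof unfold_locales
    show "\<exists>z. Im z > 0 \<and> \<theta> z = w" for w using theta_surj by force
    show "finf z = ca * fa z ^ p + cb * fb z ^ q" if "Im z > 0" for z using c_rel that by simp
  qed (use pq(3) rpq br c_nz alpha_lift beta_lift in auto)
  have G: "G = lgen T.gens" unfolding G_def T.gens_def ..
  have \<Psi>: "\<Psi> = T.\<Psi>" by (rule ext) (auto simp: Psi_def T.\<Psi>_def)
  show ?thesis
    unfolding G \<Psi>
  proof (intro conjI ballI allI impI)
    show "T.\<Psi> (lact \<gamma> x) = T.\<Psi> x" if "\<gamma> \<in> lgen T.gens" "x \<in> UHP \<times> UNIV" for \<gamma> x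
      using T.\<Psi>_invariant[OF that(1)] that(2) by auto
    show "cb * fst (T.\<Psi> x) ^ q + ca * snd (T.\<Psi> x) ^ p \<noteq> 0" if x: "x \<in> UHP \<times> UNIV" for x
    proof -
      obtain z u where "x = (z, u)" "Im z > 0" using x by auto
      then show ?thesis using T.\<Psi>_relation[of z u] T.finf_nonzero[of z] by simp
    qed
    show "\<exists>\<gamma>\<in>lgen T.gens. lact \<gamma> x = y"
      if "x \<in> UHP \<times> UNIV" "y \<in> UHP \<times> UNIV" "T.\<Psi> x = T.\<Psi> y" for x y
      using T.\<Psi>_injective[of "fst x" "fst y" "snd x" "snd y"] that by (auto simp: orb_def)
    show "\<exists>x\<in>UHP \<times> UNIV. T.\<Psi> x = v" if v: "cb * fst v ^ q + ca * snd v ^ p \<noteq> 0" for v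
    proof -
      obtain z u where "Im z > 0" "T.\<Psi> (z, u) = (fst v, snd v)" using T.\<Psi>_surj[OF v] by blast
      then show ?thesis by (intro bexI[of _ "(z, u)"]) auto
    qed
    show "\<exists>D. (T.\<Psi> has_derivative D) (at x) \<and> clinear2 D \<and> bij D" if x: "x \<in> UHP \<times> UNIV" for x
    proof -
      obtain z u where "x = (z, u)" "Im z > 0" using x by auto
      then show ?thesis using T.\<Psi>_derivative by simp
    qed
  qed
qed

end
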